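(* Let $s\ge1$, $\alpha>1$, weights $(\gamma_{\mathfrak u})_{\mathfrak u\subset\mathbb N}$ with $\gamma_\emptyset=1$, and $n$ prime be given. Let $\boldsymbol z$ be the generating vector obtained from the component-by-component (CBC) construction with search criterion $\mathcal S_s(\boldsymbol z)$, and let $A_n^*(f)=f_n$ be the kernel interpolant of $f$ at the lattice points generated by $\boldsymbol z$. Then the worst case $L_2$ approximation error satisfies, for all $\lambda\in(\frac1\alpha,1]$, $$e^{\rm wor}(A_n^*;L_2)\ \le\ \sqrt2\,[\mathcal S_s(\boldsymbol z)]^{1/4}\ \le\ \frac{\kappa}{n^{1/(4\lambda)}}\Big(\sum_{\mathfrak u\subseteq\{1,\dots,s\}}\max(|\mathfrak u|,1)\,\gamma_{\mathfrak u}^\lambda\,[2\zeta(\alpha\lambda)]^{|\mathfrak u|}\Big)^{1/(2\lambda)},$$ with $\kappa=\sqrt2\,[\max(6,\,2.5+2^{2\alpha\lambda+1})]^{1/(4\lambda)}$ and $\zeta(x)=\sum_{k=1}^\infty k^{-x}$, $x>1$, the Riemann zeta function. Hence $$e^{\rm wor}(A_n^*;L_2)=\mathcal O(n^{-\alpha/4+\delta})\qquad\text{for every }\delta\in(0,\alpha/4),$$ where the implied constant depends on $\delta$ but is independent of $s$ provided that $$\sum_{\mathfrak u\subset\mathbb N,\ |\mathfrak u|<\infty}\max(|\mathfrak u|,1)\,\gamma_{\mathfrak u}^{\frac1{\alpha-4\delta}}\,\big[2\zeta\big(\tfrac{\alpha}{\alpha-4\delta}\big)\big]^{|\mathfrak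 u|}<\infty .$$
   Context: Weights: $\gamma_{\mathfrak u}>0$ for every finite $\mathfrak u\subset\mathbb N$, $\gamma_\emptyset=1$. For $\boldsymbol h\in\mathbb Z^s$: $\mathrm{supp}(\boldsymbol h)=\{j:h_j\neq0\}$, $r(\boldsymbol h)=\gamma_{\mathrm{supp}(\boldsymbol h)}^{-1}\prod_{j\in\mathrm{supp}(\boldsymbol h)}|h_j|^\alpha$. $H=H_{s,\alpha,\boldsymbol\gamma}$ is the Hilbert space of real-valued 1-periodic functions on $[0,1]^s$ with absolutely convergent Fourier series (Fourier coefficients $\widehat f(\boldsymbol h)$) and finite norm $\|f\|_H=(\sum_{\boldsymbol h\in\mathbb Z^s}r(\boldsymbol h)|\widehat f(\boldsymbol h)|^2)^{1/2}$. It has reproducing kernel $K(\boldsymbol y,\boldsymbol y')=\sum_{\mathfrak u\subseteq\{1,\dots,s\}}\gamma_{\mathfrak u}\prod_{j\in\mathfrak u}\eta_\alpha(y_j-y_j')$, $\eta_\alpha(y)=\sum_{h\in\mathbb Z\setminus\{0\}}|h|^{-\alpha}e^{2\pi \mathrm i hy}$. Kernel interpolant: for $\boldsymbol z\in\{1,\dots,n-1\}^s$ and lattice points $\boldsymbol t_k=\{k\boldsymbol z/n\}$, $k=1,\dots,n$ (componentwise fractional parts), $A_n^*(f)=f_n$ is the function of the form $f_n=\sum_{k=1}^n a_kK(\boldsymbol t_k,\cdot)$ with $f_n(\boldsymbol t_k)=f(\boldsymbol t_k)$ for all $k=1,\dots,n$. Worst case error: $e^{\rm wor}(A_n^*;L_2)=\sup_{f\in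 H,\|f\|_H\le1}\|f-A_n^*(f)\|_{L_2([0,1]^s)}$. Search criterion and CBC construction (from Cools, Kuo, Nuyens, Sloan): $$\mathcal S_s(\boldsymbol z)=\sum_{\boldsymbol h\in\mathbb Z^s}\ \sum_{\boldsymbol\ell\in\mathbb Z^s\setminus\{\boldsymbol0\},\ \boldsymbol\ell\cdot\boldsymbol z\equiv0\ (\mathrm{mod}\ n)}\frac1{r(\boldsymbol h)\,r(\boldsymbol h+\boldsymbol\ell)}=\sum_{d=1}^sT_d(z_1,\dots,z_d),$$ where $T_d(z_1,\dots,z_d)$ is the part of the sum over those $\boldsymbol\ell$ with $\ell_d\neq0$ and $\ell_j=0$ for all $j>d$ (it depends only on $z_1,\dots,z_d$). The CBC construction chooses, for $d=1,2,\dots,s$ successively, with $z_1,\dots,z_{d-1}$ already fixed, $z_d\in\{1,\dots,n-1\}$ minimizing $T_d(z_1,\dots,z_d)$.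
   Formalization: For α−4δ<1 the printed condition does not give a constant independent of s (e.g. γ_{j}=1/j, other weights tiny); there independence of s is stated instead under Σ max(|u|,1) γ_u [2ζ(α)]^{|u|} < ∞. For α−4δ≥1 the condition is as printed. *)

theory Defs
  imports "HOL-Analysis.Analysis" "HOL-Number_Theory.Cong"
begin

text \<open>
  Coordinates are indexed from 1, so a coordinate set is a finite subset of \<open>{1..}\<close>.
  The dimension \<open>s\<close> is a term, not a type, because the theorem compares different \<open>s\<close>.
  Elements of \<open>\<int>\<^sup>s\<close> are integer sequences vanishing outside \<open>{1..s}\<close>, which makes vector addition
  pointwise addition and embeds \<open>\<int>\<^sup>d\<close> in \<open>\<int>\<^sup>s\<close> for \<open>d \<le> s\<close>.  Points of \<open>\<real>\<^sup>s\<close> are elements of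
  \<open>{1..s} \<rightarrow>\<^sub>E UNIV\<close>, as required by the product measure \<open>Pi\<^sub>M\<close>.
\<close>

definition weights :: "(nat set \<Rightarrow> real) \<Rightarrow> bool" where
  "weights \<gamma> \<longleftrightarrow> (\<forall>u. finite u \<and> u \<subseteq> {1..} \<longrightarrow> \<gamma> u > 0) \<and> \<gamma> {} = 1"

definition int_vecs :: "nat \<Rightarrow> (nat \<Rightarrow> int) set" where
  "int_vecs s = {h. \<forall>j. j \<notin> {1..s} \<longrightarrow> h j = 0}"

definition supp :: "(nat \<Rightarrow> int) \<Rightarrow> nat set" where
  "supp h = {j. h j \<noteq> 0}"

definition r :: "real \<Rightarrow> (nat set \<Rightarrow> real) \<Rightarrow> (nat \<Rightarrow> int) \<Rightarrow> real" where
  "r \<alpha> \<gamma> h = inverse (\<gamma> (supp h)) * (\<Prod>j\<in>supp h. \<bar>real_of_int (h j)\<bar> powr \<alpha>)"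

definition unit_cube :: "nat \<Rightarrow> (nat \<Rightarrow> real) measure" where
  "unit_cube s = Pi\<^sub>M {1..s} (\<lambda>_. restrict_space lborel {0..1})"

definition fourier_char :: "nat \<Rightarrow> (nat \<Rightarrow> int) \<Rightarrow> (nat \<Rightarrow> real) \<Rightarrow> complex" where
  "fourier_char s h x = exp (2 * of_real pi * \<i> * of_real (\<Sum>j=1..s. real_of_int (h j) * x j))"

definition fourier_coeff :: "nat \<Rightarrow> ((nat \<Rightarrow> real) \<Rightarrow> real) \<Rightarrow> (nat \<Rightarrow> int) \<Rightarrow> complex" where
  "fourier_coeff s f h = (LINT x|unit_cube s. of_real (f x) * cnj (fourier_char s h x))"

text \<open>
  Functions on the unit cube are represented by their 1-periodic extensions to \<open>\<real>\<^sup>s\<close>; absolute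
  convergence of the Fourier series includes that the series represents \<open>f\<close> at every point.
\<close>

definition H_space :: "nat \<Rightarrow> real \<Rightarrow> (nat set \<Rightarrow> real) \<Rightarrow> ((nat \<Rightarrow> real) \<Rightarrow> real) set" where
  "H_space s \<alpha> \<gamma> = {f.
     (\<forall>x\<in>{1..s} \<rightarrow>\<^sub>E UNIV. \<forall>j\<in>{1..s}. f (x(j := x j + 1)) = f x) \<and>
     integrable (unit_cube s) f \<and>
     (\<lambda>h. cmod (fourier_coeff s f h)) summable_on int_vecs s \<and>
     (\<forall>x\<in>{1..s} \<rightarrow>\<^sub>E UNIV.
        ((\<lambda>h. fourier_coeff s f h * fourier_char s h x) has_sum of_real (f x)) (int_vecs s)) \<and>
     (\<lambda>h. r \<alpha> \<gamma> h * (cmod (fourier_coeff s f h))\<^sup>2) summable_on int_vecs s}"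

definition H_norm :: "nat \<Rightarrow> real \<Rightarrow> (nat set \<Rightarrow> real) \<Rightarrow> ((nat \<Rightarrow> real) \<Rightarrow> real) \<Rightarrow> real" where
  "H_norm s \<alpha> \<gamma> f =
     sqrt (\<Sum>\<^sub>\<infinity>h\<in>int_vecs s. r \<alpha> \<gamma> h * (cmod (fourier_coeff s f h))\<^sup>2)"

text \<open>The series below has conjugate terms at \<open>h\<close> and \<open>-h\<close>, hence a real sum.\<close>

definition eta :: "real \<Rightarrow> real \<Rightarrow> real" where
  "eta \<alpha> y = Re (\<Sum>\<^sub>\<infinity>h\<in>UNIV - {0 :: int}.
     of_real (\<bar>real_of_int h\<bar> powr (- \<alpha>)) * exp (2 * of_real pi * \<i> * of_int h * of_real y))"

definition kernel :: "nat \<Rightarrow> real \<Rightarrow> (nat set \<Rightarrow> real) \<Rightarrow> (nat \<Rightarrow> real) \<Rightarrow> (nat \<Rightarrow> real) \<Rightarrow> real" where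
  "kernel s \<alpha> \<gamma> y y' = (\<Sum>u\<in>Pow {1..s}. \<gamma> u * (\<Prod>j\<in>u. eta \<alpha> (y j - y' j)))"

definition lattice_point :: "nat \<Rightarrow> nat \<Rightarrow> (nat \<Rightarrow> nat) \<Rightarrow> nat \<Rightarrow> nat \<Rightarrow> real" where
  "lattice_point s n z k = (\<lambda>j\<in>{1..s}. frac (real k * real (z j) / real n))"

definition kernel_interpolant ::
  "nat \<Rightarrow> real \<Rightarrow> (nat set \<Rightarrow> real) \<Rightarrow> nat \<Rightarrow> (nat \<Rightarrow> nat)
     \<Rightarrow> ((nat \<Rightarrow> real) \<Rightarrow> real) \<Rightarrow> (nat \<Rightarrow> real) \<Rightarrow> real" where
  "kernel_interpolant s \<alpha> \<gamma> n z f = (THE g.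
     (\<exists>a :: nat \<Rightarrow> real. g = (\<lambda>y. \<Sum>k=1..n. a k * kernel s \<alpha> \<gamma> (lattice_point s n z k) y)) \<and>
     (\<forall>k\<in>{1..n}. g (lattice_point s n z k) = f (lattice_point s n z k)))"

definition L2_norm :: "nat \<Rightarrow> ((nat \<Rightarrow> real) \<Rightarrow> real) \<Rightarrow> real" where
  "L2_norm s f = sqrt (LINT x|unit_cube s. (f x)\<^sup>2)"

text \<open>
  The supremum is taken in \<open>ereal\<close>, where it is meaningful without a boundedness assumption.
\<close>

definition wce :: "nat \<Rightarrow> real \<Rightarrow> (nat set \<Rightarrow> real) \<Rightarrow> nat \<Rightarrow> (nat \<Rightarrow> nat) \<Rightarrow> ereal" where
  "wce s \<alpha> \<gamma> n z = (SUP f\<in>{f \<in> H_space s \<alpha> \<gamma>. H_norm s \<alpha> \<gamma> f \<le> 1}.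
     ereal (L2_norm s (\<lambda>x. f x - kernel_interpolant s \<alpha> \<gamma> n z f x)))"

definition dual_lattice :: "nat \<Rightarrow> nat \<Rightarrow> (nat \<Rightarrow> nat) \<Rightarrow> (nat \<Rightarrow> int) set" where
  "dual_lattice s n z = {l \<in> int_vecs s. [(\<Sum>j=1..s. l j * int (z j)) = 0] (mod int n)}"

definition S_crit :: "nat \<Rightarrow> real \<Rightarrow> (nat set \<Rightarrow> real) \<Rightarrow> nat \<Rightarrow> (nat \<Rightarrow> nat) \<Rightarrow> real" where
  "S_crit s \<alpha> \<gamma> n z =
     (\<Sum>\<^sub>\<infinity>h\<in>int_vecs s. \<Sum>\<^sub>\<infinity>l\<in>dual_lattice s n z - {\<lambda>_. 0}.
        1 / (r \<alpha> \<gamma> h * r \<alpha> \<gamma> (\<lambda>j. h j + l j)))"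

text \<open>
  Only \<open>l\<close> is truncated at coordinate \<open>d\<close>; the outer sum stays over \<open>\<int>\<^sup>s\<close>, so the value also depends
  on \<open>s\<close>.  It does not depend on \<open>z j\<close> for \<open>j > d\<close>.
\<close>

definition T_crit :: "nat \<Rightarrow> real \<Rightarrow> (nat set \<Rightarrow> real) \<Rightarrow> nat \<Rightarrow> nat \<Rightarrow> (nat \<Rightarrow> nat) \<Rightarrow> real" where
  "T_crit s \<alpha> \<gamma> n d z =
     (\<Sum>\<^sub>\<infinity>h\<in>int_vecs s. \<Sum>\<^sub>\<infinity>l\<in>{l \<in> dual_lattice s n z. l d \<noteq> 0 \<and> (\<forall>j>d. l j = 0)}.
        1 / (r \<alpha> \<gamma> h * r \<alpha> \<gamma> (\<lambda>j. h j + l j)))"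

text \<open>
  A minimizer need not be unique; the predicate holds for every possible output of the
  construction, whatever the tie-breaking.
\<close>

definition cbc_vector :: "nat \<Rightarrow> real \<Rightarrow> (nat set \<Rightarrow> real) \<Rightarrow> nat \<Rightarrow> (nat \<Rightarrow> nat) \<Rightarrow> bool" where
  "cbc_vector s \<alpha> \<gamma> n z \<longleftrightarrow> (\<forall>d\<in>{1..s}. z d \<in> {1..n - 1} \<and>
     (\<forall>w\<in>{1..n - 1}. T_crit s \<alpha> \<gamma> n d z \<le> T_crit s \<alpha> \<gamma> n d (z(d := w))))"

definition zeta :: "real \<Rightarrow> real" where
  "zeta x = (\<Sum>k. real (Suc k) powr (- x))"

definition kappa :: "real \<Rightarrow> real \<Rightarrow> real" where
  "kappa \<alpha> p = sqrt 2 * (max 6 (2.5 + 2 powr (2 * \<alpha> * p + 1))) powr (1 / (4 * p))"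

end

theory Submission
  imports Defs "HOL-Probability.Infinite_Product_Measure"
begin

text \<open>
  The kernel interpolant is the orthogonal projection of \<open>f\<close> onto the span of the kernel sections at
  the lattice points, so the error \<open>g\<close> vanishes at these points and has norm at most
  \<open>\<parallel>f\<parallel> \<le> 1\<close>.  Because \<open>g\<close> vanishes there, each Fourier coefficient of \<open>g\<close> is minus the sum of the
  others in its coset of the dual lattice.  By Cauchy-Schwarz its squared modulus is at most
  \<open>\<Sum>\<^sub>l 1 / r (h + l)\<close>, and a second application of Cauchy-Schwarz gives \<open>\<parallel>g\<parallel>\<^sup>2 \<le> sqrt S\<close> in \<open>L\<^sub>2\<close>.

  For the bound on \<open>S\<close>, each \<open>T\<^sub>d powr p\<close> is bounded by Jensen's inequality and by averaging over the
  candidates for \<open>z d\<close>.  A vector \<open>l\<close> with \<open>\<not> n dvd l d\<close> survives for at most one candidate, and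
  the total contribution of these vectors over all \<open>d\<close> is at most \<open>(\<Sum>\<^sub>h 1 / r h powr p)\<^sup>2 / (n - 1)\<close>.  If
  \<open>n dvd l d\<close>, one of \<open>h d\<close> and \<open>h d + l d\<close> is large, which gains a factor \<open>(2 / n) powr (\<alpha> * p)\<close>.
\<close>

section \<open>Infinite sums over integer vectors\<close>

text \<open>The weights are arbitrary functions of the support, so \<open>1 / r\<close> does not
  factorise over coordinates. The estimates handle whole vectors: sums are split by support, and the
  one change made to a single coordinate keeps the support and with it the weight. A power
  \<open>p\<close> can be taken inside because \<open>1 / r\<close> raised to \<open>p\<close> has
  the same form with exponent \<open>\<alpha> * p\<close> and weights
  \<open>\<gamma> u powr p\<close>, and \<open>\<alpha> * p > 1\<close> keeps the sums convergent.
  The factor \<open>max (card u) 1\<close> arises from the sum over \<open>d\<close>: a support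
  \<open>u\<close> is met once for each \<open>d \<in> u\<close>, and the maximum with 1 lets the
  same expression dominate the plain sum over all supports. The interpolant is a definite
  description, so existence and uniqueness precede any use of it. Uniqueness follows from positive
  Fourier coefficients of the kernel, existence from nonzero eigenvalues of a circulant
  matrix.\<close>

lemma has_sum_sum:
  fixes f :: "'i \<Rightarrow> 'a \<Rightarrow> 'b :: topological_comm_monoid_add"
  assumes "\<And>i. i \<in> F \<Longrightarrow> (f i has_sum S i) A"
  shows "((\<lambda>x. \<Sum>i\<in>F. f i x) has_sum (\<Sum>i\<in>F. S i)) A"
  using assms by (induction F rule: infinite_finite_induct) (auto intro: has_sum_add)

lemma has_sum_diff:
  fixes f g :: "'a \<Rightarrow> 'b :: real_normed_vector"
  assumes "(f has_sum a) A" "(g has_sum b) A"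
  shows "((\<lambda>x. f x - g x) has_sum a - b) A"
proof -
  have "((\<lambda>x. - g x) has_sum - b) A" using assms(2) by (simp add: has_sum_uminus)
  from has_sum_add[OF assms(1) this] show ?thesis by simp
qed

lemma has_sum_prod_PiE:
  fixes f :: "'a \<Rightarrow> 'b \<Rightarrow> 'c :: {real_normed_field, banach, second_countable_topology}"
  assumes "finite A" and "\<And>x. x \<in> A \<Longrightarrow> countable (B x)"
    and "\<And>x. x \<in> A \<Longrightarrow> (\<lambda>y. norm (f x y)) summable_on B x"
  shows "((\<lambda>g. \<Prod>x\<in>A. f x (g x)) has_sum (\<Prod>x\<in>A. infsum (f x) (B x))) (PiE A B)"
proof -
  have s: "(\<lambda>g. norm (\<Prod>x\<in>A. f x (g x))) summable_on (PiE A B)"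
    using abs_summable_on_prod_PiE[of A B f] assms by (simp add: abs_summable_equivalent)
  have "infsum (\<lambda>g. \<Prod>x\<in>A. f x (g x)) (PiE A B) = (\<Prod>x\<in>A. infsum (f x) (B x))"
    by (rule infsum_prod_PiE_abs) (use assms in auto)
  with s show "((\<lambda>g. \<Prod>x\<in>A. f x (g x)) has_sum (\<Prod>x\<in>A. infsum (f x) (B x))) (PiE A B)"
    using abs_summable_summable[OF s] unfolding has_sum_iff by simp
qed

section \<open>Decomposition of integer vectors by support\<close>

lemma finite_supp: "h \<in> int_vecs s \<Longrightarrow> finite (supp h)"
  by (rule finite_subset[of _ "{1..s}"]) (auto simp: supp_def int_vecs_def)

lemma supp_subset: "h \<in> int_vecs s \<Longrightarrow> supp h \<subseteq> {1..s}"
  by (auto simp: supp_def int_vecs_def)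

lemma bij_betw_PiE_supp:
  assumes "u \<subseteq> {1..s}"
  shows "bij_betw (\<lambda>g j. if j \<in> u then g j else 0) (PiE u (\<lambda>_. UNIV - {0})) {h \<in> int_vecs s. supp h = u}"
proof (rule bij_betwI[where g = "\<lambda>h. restrict h u"])
  show "(\<lambda>g j. if j \<in> u then g j else 0) \<in> (\<Pi>\<^sub>E j\<in>u. UNIV - {0}) \<rightarrow> {h \<in> int_vecs s. supp h = u}"
    using assms by (auto simp: int_vecs_def supp_def PiE_iff)
next
  show "(\<lambda>h. restrict h u) \<in> {h \<in> int_vecs s. supp h = u} \<rightarrow> (\<Pi>\<^sub>E j\<in>u. UNIV - {0})"
    by (auto simp: supp_def)
next
  fix g :: "nat \<Rightarrow> int" assume "g \<in> (\<Pi>\<^sub>E j\<in>u. UNIV - {0})"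
  then show "restrict (\<lambda>j. if j \<in> u then g j else 0) u = g"
    by (auto simp: fun_eq_iff restrict_def PiE_def extensional_def)
next
  fix h assume "h \<in> {h \<in> int_vecs s. supp h = u}"
  then show "(\<lambda>j. if j \<in> u then restrict h u j else 0) = h"
    by (auto simp: fun_eq_iff supp_def)
qed

text \<open>Grouping the vectors by support makes the weight constant on each group, where the
  remaining product sums factor by factor over the nonzero integers. The field is general because
  the real case gives the sum of \<open>1 / r\<close> and the complex case the kernel.\<close>

lemma has_sum_int_vecs_prod:
  fixes \<phi> :: "nat \<Rightarrow> int \<Rightarrow> 'c :: {real_normed_field, banach, second_countable_topology}"
    and w :: "nat set \<Rightarrow> 'c"
  assumes "\<And>j. j \<in> {1..s} \<Longrightarrow> (\<lambda>m. norm (\<phi> j m)) summable_on (UNIV - {0})"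
  shows "((\<lambda>h. w (supp h) * (\<Prod>j\<in>supp h. \<phi> j (h j))) has_sum
           (\<Sum>u\<in>Pow {1..s}. w u * (\<Prod>j\<in>u. infsum (\<phi> j) (UNIV - {0})))) (int_vecs s)"
proof -
  define F where "F h = w (supp h) * (\<Prod>j\<in>supp h. \<phi> j (h j))" for h
  have "(F has_sum (w u * (\<Prod>j\<in>u. infsum (\<phi> j) (UNIV - {0})))) {h \<in> int_vecs s. supp h = u}"
    if u: "u \<in> Pow {1..s}" for u
  proof -
    have "((\<lambda>g. \<Prod>x\<in>u. \<phi> x (g x)) has_sum (\<Prod>x\<in>u. infsum (\<phi> x) (UNIV - {0}))) (PiE u (\<lambda>_. UNIV - {0}))"
      by (rule has_sum_prod_PiE) (use u assms in \<open>auto intro: finite_subset\<close>)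
    then have "((\<lambda>g. w u * (\<Prod>x\<in>u. \<phi> x (g x))) has_sum (w u * (\<Prod>x\<in>u. infsum (\<phi> x) (UNIV - {0}))))
        (PiE u (\<lambda>_. UNIV - {0}))"
      by (rule has_sum_cmult_right)
    \<comment> \<open>The \<open>if\<close> exhibits the summand as a function of the zero-extended
      vector, ready for reindexing by \<open>bij_betw_PiE_supp\<close>.\<close>
    also have "(\<lambda>g. w u * (\<Prod>x\<in>u. \<phi> x (g x))) = (\<lambda>g. w u * (\<Prod>x\<in>u. \<phi> x (if x \<in> u then g x else 0)))"
      by (auto simp: fun_eq_iff intro: prod.cong)
    also have "(\<dots> has_sum (w u * (\<Prod>x\<in>u. infsum (\<phi> x) (UNIV - {0})))) (PiE u (\<lambda>_. UNIV - {0})) \<longleftrightarrow>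
      ((\<lambda>h. w u * (\<Prod>x\<in>u. \<phi> x (h x))) has_sum (w u * (\<Prod>x\<in>u. infsum (\<phi> x) (UNIV - {0}))))
        {h \<in> int_vecs s. supp h = u}"
      by (rule has_sum_reindex_bij_betw[OF bij_betw_PiE_supp]) (use u in auto)
    finally show ?thesis
      by (rule has_sum_cong[THEN iffD1, rotated]) (auto simp: F_def)
  qed
  then have "(F has_sum (\<Sum>u\<in>Pow {1..s}. w u * (\<Prod>j\<in>u. infsum (\<phi> j) (UNIV - {0}))))
      (\<Union>u\<in>Pow {1..s}. {h \<in> int_vecs s. supp h = u})"
    by (intro sum_has_sum) auto
  also have "(\<Union>u\<in>Pow {1..s}. {h \<in> int_vecs s. supp h = u}) = int_vecs s"
    using supp_subset by auto
  finally show ?thesis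
    by (simp add: F_def)
qed

section \<open>Zeta values and the sum of 1 / r\<close>

lemma zeta_pos: "c > 1 \<Longrightarrow> zeta c > 0"
proof -
  assume c: "c > 1"
  have "summable (\<lambda>k. real (Suc k) powr (- c))"
    using summable_real_powr_iff[of "-c"] c by (subst summable_Suc_iff) auto
  then show ?thesis
    unfolding zeta_def by (intro suminf_pos) auto
qed

lemma has_sum_zeta:
  assumes "c > 1"
  shows "((\<lambda>m. \<bar>real_of_int m\<bar> powr (- c)) has_sum 2 * zeta c) (UNIV - {0})"
proof -
  define f where "f m = \<bar>real_of_int m\<bar> powr (- c)" for m
  have s: "summable (\<lambda>k. real (Suc k) powr (- c))"
    using summable_real_powr_iff[of "-c"] assms by (subst summable_Suc_iff) auto
  then have z: "((\<lambda>k. real (Suc k) powr (- c)) has_sum zeta c) UNIV"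
    unfolding zeta_def by (intro sums_nonneg_imp_has_sum) (auto simp: summable_sums)
  have "bij_betw (\<lambda>k. int (Suc k)) UNIV {1..}"
    by (rule bij_betwI[where g = "\<lambda>m. nat (m - 1)"]) auto
  from has_sum_reindex_bij_betw[OF this, of f] z have 1: "(f has_sum zeta c) {1..}"
    by (simp add: f_def add.commute)
  have "bij_betw (\<lambda>k. - int (Suc k)) UNIV {..-1}"
    by (rule bij_betwI[where g = "\<lambda>m. nat (- m - 1)"]) auto
  from has_sum_reindex_bij_betw[OF this, of f] z have 2: "(f has_sum zeta c) {..-1}"
    by (simp add: f_def add.commute)
  have "(f has_sum (zeta c + zeta c)) ({1..} \<union> {..-1})"
    by (rule has_sum_Un_disjoint[OF 1 2]) auto
  also have "{1..} \<union> {..-1} = UNIV - {0::int}"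
    by auto
  finally show ?thesis
    by (simp add: f_def[abs_def])
qed

text \<open>The reciprocal of \<open>r\<close>. Exponent and weights are parameters so that its
  powers (\<open>rho_powr\<close>) and its restrictions to some of the supports are again
  instances.\<close>

definition rho :: "real \<Rightarrow> (nat set \<Rightarrow> real) \<Rightarrow> (nat \<Rightarrow> int) \<Rightarrow> real" where
  "rho c w h = w (supp h) * (\<Prod>j\<in>supp h. \<bar>real_of_int (h j)\<bar> powr (- c))"

lemma inverse_r: "1 / r \<alpha> \<gamma> h = rho \<alpha> \<gamma> h"
  unfolding r_def rho_def powr_minus prod_inversef[unfolded comp_def] divide_inverse
  by (simp only: inverse_mult_distrib inverse_inverse_eq mult_1)

lemma inverse_r_mult: "1 / (r \<alpha> \<gamma> h * r \<alpha> \<gamma> k) = rho \<alpha> \<gamma> h * rho \<alpha> \<gamma> k"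
  by (simp only: inverse_r[symmetric] times_divide_times_eq mult_1)

lemma weights_pos:
  assumes "weights \<gamma>" "h \<in> int_vecs s"
  shows "\<gamma> (supp h) > 0"
proof -
  have "finite (supp h)" "supp h \<subseteq> {1..}"
    using finite_supp[OF assms(2)] supp_subset[OF assms(2)] by auto
  then show ?thesis
    using assms(1) unfolding weights_def by blast
qed

lemma rho_pos: "weights \<gamma> \<Longrightarrow> h \<in> int_vecs s \<Longrightarrow> rho c \<gamma> h > 0"
  unfolding rho_def by (rule mult_pos_pos[OF weights_pos prod_pos]) (auto simp: supp_def)

lemma r_pos: "weights \<gamma> \<Longrightarrow> h \<in> int_vecs s \<Longrightarrow> r \<alpha> \<gamma> h > 0"
  unfolding r_def
  by (rule mult_pos_pos[OF positive_imp_inverse_positive[OF weights_pos] prod_pos]) (auto simp: supp_def)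

lemma rho_powr:
  assumes "weights \<gamma>" "h \<in> int_vecs s"
  shows "rho \<alpha> \<gamma> h powr p = rho (\<alpha> * p) (\<lambda>u. \<gamma> u powr p) h"
proof -
  have "(\<Prod>j\<in>supp h. \<bar>real_of_int (h j)\<bar> powr - \<alpha>) powr p = (\<Prod>j\<in>supp h. \<bar>real_of_int (h j)\<bar> powr - (\<alpha> * p))"
    by (subst prod_powr_distrib) (simp add: powr_powr)
  then show ?thesis
    using weights_pos[OF assms] by (simp add: rho_def powr_mult prod_nonneg)
qed

lemma weights_powr: "weights \<gamma> \<Longrightarrow> weights (\<lambda>u. \<gamma> u powr p)"
  unfolding weights_def by (metis less_irrefl powr_gt_zero powr_one_eq_one)

lemma has_sum_rho:
  assumes "c > 1"
  shows "((\<lambda>h. rho c w h) has_sum (\<Sum>u\<in>Pow {1..s}. w u * (2 * zeta c) ^ card u)) (int_vecs s)"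
proof -
  have *: "(\<lambda>m. norm (\<bar>real_of_int m\<bar> powr - c)) summable_on UNIV - {0}"
    using has_sum_zeta[OF assms] by (simp add: has_sum_imp_summable)
  from has_sum_int_vecs_prod[of s "\<lambda>_ m. \<bar>real_of_int m\<bar> powr (- c)" w, OF *]
    infsumI[OF has_sum_zeta[OF assms]]
  show ?thesis
    by (simp add: rho_def[abs_def])
qed

section \<open>Comparison, Cauchy-Schwarz and Jensen inequalities for infinite sums\<close>

lemma infsum_le_inj:
  fixes f :: "'a \<Rightarrow> real" and g :: "'b \<Rightarrow> real"
  assumes "inj_on \<theta> A" "\<theta> ` A \<subseteq> B" "\<And>x. x \<in> A \<Longrightarrow> 0 \<le> f x" "\<And>x. x \<in> A \<Longrightarrow> f x \<le> g (\<theta> x)"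
    and "g summable_on B" "\<And>y. y \<in> B \<Longrightarrow> 0 \<le> g y"
  shows "f summable_on A" "infsum f A \<le> infsum g B"
proof -
  have s: "g summable_on \<theta> ` A"
    using assms(2,5) summable_on_subset by blast
  then have s': "(g \<circ> \<theta>) summable_on A"
    using summable_on_reindex[OF assms(1)] by blast
  show f: "f summable_on A"
    by (rule summable_on_comparison_test[OF s']) (use assms in auto)
  have "infsum f A \<le> infsum (g \<circ> \<theta>) A"
    by (rule infsum_mono[OF f s']) (use assms in auto)
  also have "\<dots> = infsum g (\<theta> ` A)"
    by (rule infsum_reindex[symmetric, OF assms(1)])
  also have "\<dots> \<le> infsum g B"
    by (rule infsum_mono2) (use assms s in auto)
  finally show "infsum f A \<le> infsum g B" .
qed

lemma infsum_Cauchy_Schwarz: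
  fixes f g :: "'a \<Rightarrow> real"
  assumes "(\<lambda>x. (f x)\<^sup>2) summable_on A" "(\<lambda>x. (g x)\<^sup>2) summable_on A"
    and "\<And>x. x \<in> A \<Longrightarrow> 0 \<le> f x" "\<And>x. x \<in> A \<Longrightarrow> 0 \<le> g x"
  shows "(\<lambda>x. f x * g x) summable_on A"
    and "(\<Sum>\<^sub>\<infinity>x\<in>A. f x * g x) \<le> sqrt (\<Sum>\<^sub>\<infinity>x\<in>A. (f x)\<^sup>2) * sqrt (\<Sum>\<^sub>\<infinity>x\<in>A. (g x)\<^sup>2)"
proof -
  let ?B = "sqrt (\<Sum>\<^sub>\<infinity>x\<in>A. (f x)\<^sup>2) * sqrt (\<Sum>\<^sub>\<infinity>x\<in>A. (g x)\<^sup>2)"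
  have bound: "(\<Sum>x\<in>F. f x * g x) \<le> ?B" if "finite F" "F \<subseteq> A" for F
  proof -
    have "(\<Sum>x\<in>F. f x * g x) \<le> L2_set f F * L2_set g F"
      by (rule order_trans[OF sum_mono L2_set_mult_ineq[of f g F]]) (simp flip: abs_mult)
    also have "\<dots> \<le> ?B"
      unfolding L2_set_def
      by (intro mult_mono real_sqrt_le_mono finite_sum_le_infsum)
         (use assms that in \<open>auto intro!: infsum_nonneg sum_nonneg\<close>)
    finally show ?thesis .
  qed
  show s: "(\<lambda>x. f x * g x) summable_on A"
    by (rule nonneg_bdd_above_summable_on) (use assms bound in \<open>auto intro!: bdd_aboveI2\<close>)
  show "(\<Sum>\<^sub>\<infinity>x\<in>A. f x * g x) \<le> ?B"
    by (rule infsum_le_finite_sums[OF s bound])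
qed

lemma infsum_powr_le:
  fixes f :: "'a \<Rightarrow> real"
  assumes "f summable_on A" "(\<lambda>x. f x powr p) summable_on A"
    and "\<And>x. x \<in> A \<Longrightarrow> 0 \<le> f x" "0 < p" "p \<le> 1"
  shows "infsum f A powr p \<le> (\<Sum>\<^sub>\<infinity>x\<in>A. f x powr p)"
proof (cases "infsum f A = 0")
  case True
  then show ?thesis by (simp add: infsum_nonneg)
next
  case False
  define S where "S = infsum f A"
  have S: "S > 0"
    using False infsum_nonneg[of A f] assms(3) unfolding S_def by fastforce
  \<comment> \<open>Each term is at most the total \<open>S\<close> and
    \<open>p - 1 \<le> 0\<close>, so \<open>S powr (p - 1) \<le> f x powr (p - 1)\<close>. Summing
    over \<open>x\<close> turns the left side into
    \<open>S * S powr (p - 1) = S powr p\<close>.\<close>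
  have le: "f x * S powr (p - 1) \<le> f x powr p" if x: "x \<in> A" for x
  proof (cases "f x = 0")
    case False
    then have fx: "f x > 0" using assms(3)[OF x] by linarith
    have "f x \<le> S"
      using finite_sum_le_infsum[of f A "{x}"] assms x by (simp add: S_def)
    then have "S powr (p - 1) \<le> f x powr (p - 1)"
      using fx assms(5) by (intro powr_mono2') auto
    then have "f x * S powr (p - 1) \<le> f x * f x powr (p - 1)"
      using fx by simp
    also have "\<dots> = f x powr p"
      using fx by (simp add: powr_diff)
    finally show ?thesis .
  qed auto
  have "S powr p = S * S powr (p - 1)"
    using S by (simp add: powr_diff)
  also have "\<dots> = (\<Sum>\<^sub>\<infinity>x\<in>A. f x * S powr (p - 1))"
    unfolding S_def using assms(1) by (simp add: infsum_cmult_left)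
  also have "\<dots> \<le> (\<Sum>\<^sub>\<infinity>x\<in>A. f x powr p)"
    by (rule infsum_mono) (use assms le in \<open>auto intro: summable_on_cmult_left\<close>)
  finally show ?thesis by (simp add: S_def)
qed

section \<open>The component-by-component construction\<close>

lemma int_vecs_add: "h \<in> int_vecs s \<Longrightarrow> l \<in> int_vecs s \<Longrightarrow> (\<lambda>j. h j + l j) \<in> int_vecs s"
  by (simp add: int_vecs_def)

lemma int_vecs_diff: "h \<in> int_vecs s \<Longrightarrow> l \<in> int_vecs s \<Longrightarrow> (\<lambda>j. h j - l j) \<in> int_vecs s"
  by (simp add: int_vecs_def)

lemma int_vecs_upd: "h \<in> int_vecs s \<Longrightarrow> d \<in> {1..s} \<Longrightarrow> h(d := m) \<in> int_vecs s"
  by (auto simp: int_vecs_def)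

text \<open>The summand of the criterion on pairs, so that every truncation is a sum of one function
  over a set of pairs and can be split or enlarged by set operations.\<close>

definition shifted_prod :: "((nat \<Rightarrow> int) \<Rightarrow> real) \<Rightarrow> (nat \<Rightarrow> int) \<times> (nat \<Rightarrow> int) \<Rightarrow> real" where
  "shifted_prod f = (\<lambda>(h, l). f h * f (\<lambda>j. h j + l j))"

lemma summable_prod_nonneg:
  fixes f :: "'a \<Rightarrow> real" and g :: "'b \<Rightarrow> real"
  assumes "f summable_on A" "g summable_on B" "\<And>x. x \<in> A \<Longrightarrow> 0 \<le> f x" "\<And>x. x \<in> B \<Longrightarrow> 0 \<le> g x"
  shows "(\<lambda>(x, y). f x * g y) summable_on A \<times> B"
    and "(\<Sum>\<^sub>\<infinity>(x, y)\<in>A \<times> B. f x * g y) = infsum f A * infsum g B"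
proof -
  show s: "(\<lambda>(x, y). f x * g y) summable_on A \<times> B"
  proof (rule summable_on_SigmaI[where g = "\<lambda>x. f x * infsum g B"])
    fix x assume "x \<in> A"
    show "((\<lambda>y. case (x, y) of (x, y) \<Rightarrow> f x * g y) has_sum f x * infsum g B) B"
      using assms(2) by (simp add: has_sum_cmult_right)
  qed (use assms in \<open>auto intro: summable_on_cmult_left\<close>)
  show "(\<Sum>\<^sub>\<infinity>(x, y)\<in>A \<times> B. f x * g y) = infsum f A * infsum g B"
    using infsum_Sigma'_banach[OF s] assms
    by (simp add: infsum_cmult_right infsum_cmult_left)
qed

lemma shift_bij:
  "bij_betw (\<lambda>(h, l). (h, \<lambda>j. h j + l j)) (int_vecs s \<times> int_vecs s) (int_vecs s \<times> int_vecs s)"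
  by (rule bij_betwI[where g = "\<lambda>(h, k). (h, \<lambda>j. k j - h j)"]) (auto simp: int_vecs_def)

text \<open>The substitution \<open>k = h + l\<close> is a bijection on pairs and decouples the two
  factors; the unrestricted double sum is therefore a square.\<close>

lemma shifted_prod_summable:
  assumes "f summable_on int_vecs s" "\<And>h. h \<in> int_vecs s \<Longrightarrow> 0 \<le> f h"
  shows "shifted_prod f summable_on int_vecs s \<times> int_vecs s"
    and "infsum (shifted_prod f) (int_vecs s \<times> int_vecs s) = (infsum f (int_vecs s))\<^sup>2"
proof -
  have eq: "shifted_prod f = (\<lambda>x. (\<lambda>(x, y). f x * f y) ((\<lambda>(h, l). (h, \<lambda>j. h j + l j)) x))"
    by (auto simp: shifted_prod_def fun_eq_iff)
  show "shifted_prod f summable_on int_vecs s \<times> int_vecs s"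
    unfolding eq summable_on_reindex_bij_betw[OF shift_bij]
    by (rule summable_prod_nonneg) (use assms in auto)
  show "infsum (shifted_prod f) (int_vecs s \<times> int_vecs s) = (infsum f (int_vecs s))\<^sup>2"
    unfolding eq infsum_reindex_bij_betw[OF shift_bij] power2_eq_square
    by (rule summable_prod_nonneg) (use assms in auto)
qed

lemma shifted_prod_nonneg:
  assumes "\<And>h. h \<in> int_vecs s \<Longrightarrow> 0 \<le> f h" "x \<in> int_vecs s \<times> int_vecs s"
  shows "0 \<le> shifted_prod f x"
  using assms int_vecs_add by (auto simp: shifted_prod_def)

text \<open>The vectors whose last nonzero coordinate is \<open>d\<close>. For \<open>d\<close> in
  \<open>{1..s}\<close> these classes partition the nonzero vectors, which splits
  \<open>S_crit\<close> into the \<open>T_crit\<close>.\<close>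

definition vecs_upto :: "nat \<Rightarrow> nat \<Rightarrow> (nat \<Rightarrow> int) set" where
  "vecs_upto s d = {l \<in> int_vecs s. l d \<noteq> 0 \<and> (\<forall>j>d. l j = 0)}"

lemma vecs_upto_subset: "vecs_upto s d \<subseteq> int_vecs s"
  by (auto simp: vecs_upto_def)

lemma vecs_upto_disjoint: "d \<noteq> d' \<Longrightarrow> vecs_upto s d \<inter> vecs_upto s d' = {}"
  by (auto simp: vecs_upto_def) (metis linorder_neqE_nat)

lemma UN_vecs_upto: "(\<Union>d\<in>{1..s}. vecs_upto s d) = int_vecs s - {\<lambda>_. 0}"
proof safe
  fix l assume l: "l \<in> int_vecs s" "l \<notin> (\<Union>d\<in>{1..s}. vecs_upto s d)"
  show "l = (\<lambda>_. 0)"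
  proof (rule ccontr)
    assume "l \<noteq> (\<lambda>_. 0)"
    then have ne: "supp l \<noteq> {}" by (auto simp: supp_def)
    define d where "d = Max (supp l)"
    have d: "d \<in> supp l"
      unfolding d_def using finite_supp[OF l(1)] ne by (rule Max_in)
    moreover have "l j = 0" if "j > d" for j
      using Max_ge[OF finite_supp[OF l(1)], of j] that unfolding d_def by (fastforce simp: supp_def)
    ultimately have "l \<in> vecs_upto s d" "d \<in> {1..s}"
      using l(1) supp_subset[OF l(1)] by (auto simp: vecs_upto_def supp_def)
    with l(2) show False by blast
  qed
qed (auto simp: vecs_upto_def)

lemma rho_summable: "c > 1 \<Longrightarrow> rho c w summable_on int_vecs s"
  using has_sum_rho has_sum_imp_summable by blast

lemma rho_nonneg: "weights \<gamma> \<Longrightarrow> h \<in> int_vecs s \<Longrightarrow> 0 \<le> rho c \<gamma> h"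
  using rho_pos less_imp_le by blast

lemma shifted_rho_summable:
  "\<alpha> > 1 \<Longrightarrow> weights \<gamma> \<Longrightarrow> A \<subseteq> int_vecs s \<Longrightarrow> shifted_prod (rho \<alpha> \<gamma>) summable_on int_vecs s \<times> A"
  by (rule summable_on_subset_banach[OF shifted_prod_summable(1)[OF rho_summable rho_nonneg]]) auto

lemma double_sum_eq:
  assumes "\<alpha> > 1" "weights \<gamma>" "A \<subseteq> int_vecs s"
  shows "(\<Sum>\<^sub>\<infinity>h\<in>int_vecs s. \<Sum>\<^sub>\<infinity>l\<in>A. 1 / (r \<alpha> \<gamma> h * r \<alpha> \<gamma> (\<lambda>j. h j + l j))) =
         infsum (shifted_prod (rho \<alpha> \<gamma>)) (int_vecs s \<times> A)"
  using infsum_Sigma_banach[OF shifted_rho_summable[OF assms]]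
  by (simp add: inverse_r_mult shifted_prod_def)

lemma S_crit_eq:
  assumes \<alpha>: "\<alpha> > 1" and \<gamma>: "weights \<gamma>"
  shows "S_crit s \<alpha> \<gamma> n z = infsum (shifted_prod (rho \<alpha> \<gamma>)) (int_vecs s \<times> (dual_lattice s n z - {\<lambda>_. 0}))"
  unfolding S_crit_def by (rule double_sum_eq[OF \<alpha> \<gamma>]) (auto simp: dual_lattice_def)

lemma T_crit_eq:
  assumes \<alpha>: "\<alpha> > 1" and \<gamma>: "weights \<gamma>"
  shows "T_crit s \<alpha> \<gamma> n d z = infsum (shifted_prod (rho \<alpha> \<gamma>)) (int_vecs s \<times> (dual_lattice s n z \<inter> vecs_upto s d))"
proof -
  have "{l \<in> dual_lattice s n z. l d \<noteq> 0 \<and> (\<forall>j>d. l j = 0)} = dual_lattice s n z \<inter> vecs_upto s d"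
    by (auto simp: dual_lattice_def vecs_upto_def)
  moreover have "dual_lattice s n z \<inter> vecs_upto s d \<subseteq> int_vecs s"
    using vecs_upto_subset by blast
  ultimately show ?thesis
    unfolding T_crit_def using double_sum_eq[OF \<alpha> \<gamma>] by (simp only:)
qed

lemma shifted_rho_nonneg: "weights \<gamma> \<Longrightarrow> x \<in> int_vecs s \<times> int_vecs s \<Longrightarrow> 0 \<le> shifted_prod (rho c \<gamma>) x"
  by (rule shifted_prod_nonneg[OF rho_nonneg])

lemma T_crit_nonneg:
  assumes \<alpha>: "\<alpha> > 1" and \<gamma>: "weights \<gamma>"
  shows "0 \<le> T_crit s \<alpha> \<gamma> n d z"
  unfolding T_crit_eq[OF \<alpha> \<gamma>] by (rule infsum_nonneg, rule shifted_rho_nonneg[OF \<gamma>]) (auto simp: vecs_upto_def)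

lemma S_crit_nonneg:
  assumes \<alpha>: "\<alpha> > 1" and \<gamma>: "weights \<gamma>"
  shows "0 \<le> S_crit s \<alpha> \<gamma> n z"
  unfolding S_crit_eq[OF \<alpha> \<gamma>] by (rule infsum_nonneg, rule shifted_rho_nonneg[OF \<gamma>]) (auto simp: dual_lattice_def)

lemma S_crit_eq_sum_T_crit:
  assumes \<alpha>: "\<alpha> > 1" and \<gamma>: "weights \<gamma>"
  shows "S_crit s \<alpha> \<gamma> n z = (\<Sum>d=1..s. T_crit s \<alpha> \<gamma> n d z)"
proof -
  have "(\<Sum>d=1..s. T_crit s \<alpha> \<gamma> n d z) =
      infsum (shifted_prod (rho \<alpha> \<gamma>)) (\<Union>d\<in>{1..s}. int_vecs s \<times> (dual_lattice s n z \<inter> vecs_upto s d))"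
    unfolding T_crit_eq[OF \<alpha> \<gamma>]
  proof (rule sum_infsum)
    fix d
    show "shifted_prod (rho \<alpha> \<gamma>) summable_on int_vecs s \<times> (dual_lattice s n z \<inter> vecs_upto s d)"
      by (rule shifted_rho_summable[OF \<alpha> \<gamma>]) (use vecs_upto_subset in blast)
  next
    fix d d' :: nat assume "d \<noteq> d'"
    from vecs_upto_disjoint[OF this] show "int_vecs s \<times> (dual_lattice s n z \<inter> vecs_upto s d) \<inter>
        int_vecs s \<times> (dual_lattice s n z \<inter> vecs_upto s d') = {}"
      by blast
  qed auto
  also have "(\<Union>d\<in>{1..s}. int_vecs s \<times> (dual_lattice s n z \<inter> vecs_upto s d)) =
      int_vecs s \<times> (dual_lattice s n z \<inter> (\<Union>d\<in>{1..s}. vecs_upto s d))"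
    by blast
  also have "dual_lattice s n z \<inter> (\<Union>d\<in>{1..s}. vecs_upto s d) = dual_lattice s n z - {\<lambda>_. 0}"
    unfolding UN_vecs_upto by (auto simp: dual_lattice_def)
  finally show ?thesis by (simp add: S_crit_eq[OF \<alpha> \<gamma>])
qed

section \<open>Vectors divisible by n in one coordinate\<close>

lemma rho_update_le:
  fixes n :: nat
  assumes "weights w" "c > 1" "k \<in> int_vecs s" "k d \<noteq> 0" "m \<noteq> 0" "n > 0"
    and "real n * \<bar>real_of_int m\<bar> \<le> 2 * \<bar>real_of_int (k d)\<bar>"
  shows "rho c w k \<le> (2 / real n) powr c * rho c w (k(d := m))"
proof -
  \<comment> \<open>Both values at \<open>d\<close> are nonzero, so the support and the weight stay
    the same; only the factor at \<open>d\<close> changes.\<close>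
  have supp_eq: "supp (k(d := m)) = supp k"
    using assms(4,5) by (auto simp: supp_def)
  have d: "d \<in> supp k" using assms(4) by (simp add: supp_def)
  have "\<bar>real_of_int (k d)\<bar> powr - c \<le> (real n / 2 * \<bar>real_of_int m\<bar>) powr - c"
    using assms by (intro powr_mono2') auto
  also have "\<dots> = (2 / real n) powr c * \<bar>real_of_int m\<bar> powr - c"
    using assms(6) by (simp add: powr_mult powr_divide powr_minus field_simps)
  finally have *: "\<bar>real_of_int (k d)\<bar> powr - c \<le> (2 / real n) powr c * \<bar>real_of_int m\<bar> powr - c" .
  define P where "P = (\<Prod>j\<in>supp k - {d}. \<bar>real_of_int (k j)\<bar> powr - c)"
  have P: "P \<ge> 0" by (simp add: P_def prod_nonneg)
  have 1: "rho c w k = w (supp k) * (\<bar>real_of_int (k d)\<bar> powr - c * P)"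
    by (simp add: rho_def P_def prod.remove[OF finite_supp[OF assms(3)] d])
  have "(\<Prod>j\<in>supp k - {d}. \<bar>real_of_int ((k(d := m)) j)\<bar> powr - c) = P"
    unfolding P_def by (rule prod.cong) auto
  then have 2: "rho c w (k(d := m)) = w (supp k) * (\<bar>real_of_int m\<bar> powr - c * P)"
    by (simp add: rho_def supp_eq prod.remove[OF finite_supp[OF assms(3)] d])
  have "w (supp k) * (\<bar>real_of_int (k d)\<bar> powr - c * P) \<le>
      w (supp k) * ((2 / real n) powr c * \<bar>real_of_int m\<bar> powr - c * P)"
    using weights_pos[OF assms(1,3)] P * by (intro mult_left_mono mult_right_mono) auto
  then show ?thesis
    by (simp add: 1 2 mult_ac)
qed

text \<open>
  Of two distinct integers that are congruent modulo \<open>n\<close>, the one of larger modulus is at least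
  half their distance \<open>n \<cdot> \<bar>m\<bar>\<close>; replacing it by \<open>m\<close> is injective and gains the factor \<open>(2 / n) powr c\<close>.
\<close>

lemma shifted_rho_congruent_le:
  fixes n :: nat
  assumes w: "weights w" and c: "c > 1" and n: "n > 0" and d: "d \<in> {1..s}"
    and X: "X \<subseteq> {l \<in> int_vecs s. l d \<noteq> 0 \<and> int n dvd l d}"
  shows "infsum (shifted_prod (rho c w)) (int_vecs s \<times> X) \<le>
    2 * (2 / real n) powr c * infsum (rho c w) (int_vecs s) * infsum (rho c w) {k \<in> int_vecs s. k d \<noteq> 0}"
proof -
  let ?\<rho> = "rho c w" and ?I = "int_vecs s" and ?I' = "{k \<in> int_vecs s. k d \<noteq> 0}"
  have \<rho>: "?\<rho> summable_on ?I" using rho_summable[OF c] .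
  have \<rho>': "?\<rho> summable_on ?I'" by (rule summable_on_subset_banach[OF \<rho>]) auto
  have nn: "h \<in> ?I \<Longrightarrow> 0 \<le> ?\<rho> h" for h using rho_pos[OF w] less_imp_le by blast
  define g where "g = (\<lambda>x. (2 / real n) powr c * (\<lambda>(h, k). ?\<rho> h * ?\<rho> k) x)"
  have gs: "g summable_on ?I \<times> ?I'"
    unfolding g_def by (intro summable_on_cmult_right summable_prod_nonneg \<rho> \<rho>') (auto simp: nn)
  have gi: "infsum g (?I \<times> ?I') = (2 / real n) powr c * (infsum ?\<rho> ?I * infsum ?\<rho> ?I')"
    unfolding g_def
    by (subst infsum_cmult_right', subst summable_prod_nonneg(2)[OF \<rho> \<rho>']) (auto simp: nn)
  \<comment> \<open>A tie \<open>\<bar>h d\<bar> = \<bar>h d + l d\<bar>\<close> goes to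
    \<open>X1\<close> alone, so that the cases are disjoint. Each case costs one copy of the same
    product sum, whence the factor 2.\<close>
  define X1 where "X1 = {(h, l) \<in> ?I \<times> X. \<bar>h d\<bar> \<le> \<bar>h d + l d\<bar>}"
  define X2 where "X2 = {(h, l) \<in> ?I \<times> X. \<bar>h d + l d\<bar> < \<bar>h d\<bar>}"
  have XI: "l \<in> ?I" "l d \<noteq> 0" "int n * (l d div int n) = l d" "l d div int n \<noteq> 0" if "l \<in> X" for l
    using X that by (auto simp: dvd_div_eq_0_iff)
  have dist: "real n * \<bar>real_of_int (l d div int n)\<bar> = \<bar>real_of_int (l d)\<bar>" if "l \<in> X" for l
  proof -
    have "\<bar>real_of_int (l d)\<bar> = \<bar>real_of_int (int n * (l d div int n))\<bar>"
      using XI(3)[OF that] by simp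
    then show ?thesis by (simp add: abs_mult)
  qed
  have larger: "\<bar>real_of_int (b - a)\<bar> \<le> 2 * \<bar>real_of_int b\<bar>" if "\<bar>a\<bar> \<le> \<bar>b\<bar>" for a b :: int
  proof -
    have "\<bar>b - a\<bar> \<le> 2 * \<bar>b\<bar>" using that by (auto simp: abs_if split: if_splits)
    then show ?thesis by (simp only: of_int_abs[symmetric] of_int_le_iff[where ?'a = real, symmetric] of_int_mult of_int_numeral)
  qed
  have sp: "x \<in> ?I \<times> X \<Longrightarrow> 0 \<le> shifted_prod ?\<rho> x" for x
    using shifted_prod_nonneg[of s ?\<rho> x, OF nn] XI(1) by fastforce
  \<comment> \<open>Both maps keep the vector whose entry at \<open>d\<close> is not the larger one
    and overwrite that entry of the other by the quotient \<open>l d div n\<close>. The quotient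
    determines \<open>l d\<close>, and the kept vector then returns the overwritten entry; this
    gives injectivity.\<close>
  define \<theta>1 :: "(nat \<Rightarrow> int) \<times> (nat \<Rightarrow> int) \<Rightarrow> _" where
    "\<theta>1 = (\<lambda>(h, l). (h, (\<lambda>j. h j + l j)(d := l d div int n)))"
  define \<theta>2 :: "(nat \<Rightarrow> int) \<times> (nat \<Rightarrow> int) \<Rightarrow> _" where
    "\<theta>2 = (\<lambda>(h, l). (\<lambda>j. h j + l j, h(d := l d div int n)))"
  have eq_l: "l d = l' d" if "l \<in> X" "l' \<in> X" "l d div int n = l' d div int n" for l l'
    using XI(3)[OF that(1)] XI(3)[OF that(2)] unfolding that(3) by (rule trans[OF sym])
  have inj1: "inj_on \<theta>1 X1"
  proof (rule inj_onI, clarify)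
    fix h l h' l' assume a: "(h, l) \<in> X1" "(h', l') \<in> X1" "\<theta>1 (h, l) = \<theta>1 (h', l')"
    then have e: "h = h'" "(\<lambda>j. h j + l j)(d := l d div int n) = (\<lambda>j. h' j + l' j)(d := l' d div int n)"
      by (auto simp: \<theta>1_def)
    have "l j = l' j" for j
    proof (cases "j = d")
      case True then show ?thesis
        using fun_cong[OF e(2), of d] a eq_l[of l l'] by (auto simp: X1_def)
    next
      case False then show ?thesis using fun_cong[OF e(2), of j] e(1) by auto
    qed
    with e(1) show "h = h' \<and> l = l'" by auto
  qed
  have inj2: "inj_on \<theta>2 X2"
  proof (rule inj_onI, clarify)
    fix h l h' l' assume a: "(h, l) \<in> X2" "(h', l') \<in> X2" "\<theta>2 (h, l) = \<theta>2 (h', l')"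
    then have e: "(\<lambda>j. h j + l j) = (\<lambda>j. h' j + l' j)" "h(d := l d div int n) = h'(d := l' d div int n)"
      by (auto simp: \<theta>2_def)
    have "l j = l' j \<and> h j = h' j" for j
    proof (cases "j = d")
      case True
      then have "l j = l' j"
        using fun_cong[OF e(2), of d] a eq_l[of l l'] by (auto simp: X2_def)
      then show ?thesis using fun_cong[OF e(1), of j] by auto
    next
      case False then show ?thesis using fun_cong[OF e(2), of j] fun_cong[OF e(1), of j] by auto
    qed
    then show "h = h' \<and> l = l'" by auto
  qed
  have le1: "shifted_prod ?\<rho> x \<le> g (\<theta>1 x)" if x: "x \<in> X1" for x
  proof -
    obtain h l where hl: "x = (h, l)" "h \<in> ?I" "l \<in> X" "\<bar>h d\<bar> \<le> \<bar>h d + l d\<bar>"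
      using x by (auto simp: X1_def)
    have "\<bar>real_of_int (l d)\<bar> \<le> 2 * \<bar>real_of_int (h d + l d)\<bar>"
      using larger[of "h d" "h d + l d"] hl(4) by simp
    note bound = this[folded dist[OF hl(3)]]
    \<comment> \<open>If this entry were 0, then \<open>h d\<close>, of no larger modulus, would be
      0 too, forcing \<open>l d = 0\<close>.\<close>
    have "h d + l d \<noteq> 0" using hl(4) XI(2)[OF hl(3)] by auto
    then have "?\<rho> (\<lambda>j. h j + l j) \<le> (2 / real n) powr c * ?\<rho> ((\<lambda>j. h j + l j)(d := l d div int n))"
      by (rule rho_update_le[OF w c int_vecs_add[OF hl(2) XI(1)[OF hl(3)]] _ XI(4)[OF hl(3)] n bound])
    from mult_left_mono[OF this nn[OF hl(2)]] show ?thesis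
      by (simp add: g_def \<theta>1_def shifted_prod_def hl(1) mult_ac)
  qed
  have le2: "shifted_prod ?\<rho> x \<le> g (\<theta>2 x)" if x: "x \<in> X2" for x
  proof -
    obtain h l where hl: "x = (h, l)" "h \<in> ?I" "l \<in> X" "\<bar>h d + l d\<bar> < \<bar>h d\<bar>"
      using x by (auto simp: X2_def)
    have "\<bar>real_of_int (l d)\<bar> \<le> 2 * \<bar>real_of_int (h d)\<bar>"
      using larger[of "h d + l d" "h d"] hl(4) by simp
    note bound = this[folded dist[OF hl(3)]]
    have "h d \<noteq> 0" using hl(4) by auto
    then have "?\<rho> h \<le> (2 / real n) powr c * ?\<rho> (h(d := l d div int n))"
      by (rule rho_update_le[OF w c hl(2) _ XI(4)[OF hl(3)] n bound])
    from mult_left_mono[OF this nn[OF int_vecs_add[OF hl(2) XI(1)[OF hl(3)]]]] show ?thesis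
      by (simp add: g_def \<theta>2_def shifted_prod_def hl(1) mult_ac)
  qed
  have g_nn: "0 \<le> g y" if "y \<in> ?I \<times> ?I'" for y
    using that by (auto simp: g_def intro!: mult_nonneg_nonneg nn)
  have im1: "\<theta>1 ` X1 \<subseteq> ?I \<times> ?I'"
    using d XI int_vecs_add int_vecs_upd by (fastforce simp: X1_def \<theta>1_def)
  have im2: "\<theta>2 ` X2 \<subseteq> ?I \<times> ?I'"
    using d XI int_vecs_add int_vecs_upd by (fastforce simp: X2_def \<theta>2_def)
  note b1 = infsum_le_inj[OF inj1 im1 sp le1 gs g_nn]
  note b2 = infsum_le_inj[OF inj2 im2 sp le2 gs g_nn]
  have XX: "?I \<times> X = X1 \<union> X2" "X1 \<inter> X2 = {}" by (auto simp: X1_def X2_def)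
  have "infsum (shifted_prod ?\<rho>) (?I \<times> X) = infsum (shifted_prod ?\<rho>) X1 + infsum (shifted_prod ?\<rho>) X2"
    unfolding XX(1) by (rule infsum_Un_disjoint[OF _ _ XX(2)])
      (use b1(1) b2(1) in \<open>auto simp: X1_def X2_def\<close>)
  also have "\<dots> \<le> infsum g (?I \<times> ?I') + infsum g (?I \<times> ?I')"
    by (rule add_mono[OF b1(2) b2(2)]) (auto simp: X1_def X2_def)
  finally show ?thesis
    by (simp add: gi mult_ac)
qed

section \<open>Counting supports that contain a given coordinate\<close>

lemma infsum_rho_ne_zero:
  assumes "c > 1"
  shows "infsum (rho c w) {k \<in> int_vecs s. k d \<noteq> 0} =
    (\<Sum>u\<in>Pow {1..s}. if d \<in> u then w u * (2 * zeta c) ^ card u else 0)"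
proof -
  \<comment> \<open>The constraint \<open>k d \<noteq> 0\<close> is absorbed into the weights, set
    to 0 on supports without \<open>d\<close>; \<open>has_sum_rho\<close> is stated for arbitrary
    \<open>w\<close> and covers such weights.\<close>
  have "infsum (rho c w) {k \<in> int_vecs s. k d \<noteq> 0} =
      infsum (rho c (\<lambda>u. if d \<in> u then w u else 0)) (int_vecs s)"
    by (rule infsum_cong_neutral) (auto simp: rho_def supp_def)
  also have "\<dots> = (\<Sum>u\<in>Pow {1..s}. (if d \<in> u then w u else 0) * (2 * zeta c) ^ card u)"
    by (rule infsumI[OF has_sum_rho[OF assms]])
  finally show ?thesis
    by (simp add: if_distrib[of "\<lambda>x. x * _"] cong: if_cong)
qed

text \<open>Exchanging the sums counts each support once for every coordinate in it, the origin of
  the factor \<open>card u\<close> in the final bound.\<close>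

lemma sum_infsum_rho_ne_zero:
  assumes "c > 1"
  shows "(\<Sum>d=1..s. infsum (rho c w) {k \<in> int_vecs s. k d \<noteq> 0}) =
    (\<Sum>u\<in>Pow {1..s}. real (card u) * (w u * (2 * zeta c) ^ card u))"
proof -
  have "(\<Sum>d=1..s. infsum (rho c w) {k \<in> int_vecs s. k d \<noteq> 0}) =
      (\<Sum>u\<in>Pow {1..s}. \<Sum>d=1..s. if d \<in> u then w u * (2 * zeta c) ^ card u else 0)"
    unfolding infsum_rho_ne_zero[OF assms] by (rule sum.swap)
  also have "\<dots> = (\<Sum>u\<in>Pow {1..s}. real (card u) * (w u * (2 * zeta c) ^ card u))"
  proof (rule sum.cong[OF refl])
    fix u :: "nat set" assume "u \<in> Pow {1..s}"
    then have "{1..s} \<inter> u = u" by auto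
    then show "(\<Sum>d=1..s. if d \<in> u then w u * (2 * zeta c) ^ card u else 0) =
        real (card u) * (w u * (2 * zeta c) ^ card u)"
      by (simp flip: sum.inter_restrict)
  qed
  finally show ?thesis .
qed

section \<open>Averaging over the candidates for one component\<close>

lemma dual_lattice_disjoint:
  assumes "prime n" "d \<in> {1..s}" "v \<in> {1..n - 1}" "w \<in> {1..n - 1}" "v \<noteq> w"
    and "l \<in> dual_lattice s n (z(d := v))" "l \<in> dual_lattice s n (z(d := w))"
  shows "int n dvd l d"
proof -
  have split: "(\<Sum>j=1..s. l j * int ((z(d := x)) j)) = l d * int x + (\<Sum>j\<in>{1..s} - {d}. l j * int (z j))" for x
    using assms(2) by (subst sum.remove[of _ d]) auto
  \<comment> \<open>Only coordinate \<open>d\<close> of the generating vectors differs, so the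
    difference is \<open>l d * (v - w)\<close>. By primality \<open>n\<close> divides one factor,
    and \<open>0 < \<bar>v - w\<bar> < n\<close> excludes the second.\<close>
  have "int n dvd (\<Sum>j=1..s. l j * int ((z(d := v)) j)) - (\<Sum>j=1..s. l j * int ((z(d := w)) j))"
    using assms(6,7) unfolding dual_lattice_def by (auto simp: cong_0_iff intro: dvd_diff)
  also have "\<dots> = l d * (int v - int w)"
    unfolding split by (simp add: algebra_simps)
  finally have "int n dvd l d \<or> int n dvd int v - int w"
    using assms(1) by (simp add: prime_dvd_mult_iff)
  moreover have "\<not> int n dvd int v - int w"
  proof
    assume "int n dvd int v - int w"
    then have "int n \<le> \<bar>int v - int w\<bar>"
      using assms(5) dvd_imp_le_int[of "int v - int w" "int n"] by simp
    with assms(3,4) show False by auto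
  qed
  ultimately show ?thesis by blast
qed

text \<open>Jensen's inequality moves the power inside the double sum, and \<open>rho_powr\<close>
  shows that the result is a sum of the same kind with new parameters.\<close>

lemma T_crit_powr_le_aux:
  assumes \<alpha>: "\<alpha> > 1" and \<gamma>: "weights \<gamma>" and p: "0 < p" "p \<le> 1" "\<alpha> * p > 1"
  shows "T_crit s \<alpha> \<gamma> n d z powr p \<le>
    infsum (shifted_prod (rho (\<alpha> * p) (\<lambda>u. \<gamma> u powr p))) (int_vecs s \<times> (dual_lattice s n z \<inter> vecs_upto s d))"
proof -
  let ?X = "int_vecs s \<times> (dual_lattice s n z \<inter> vecs_upto s d)"
  let ?G = "shifted_prod (rho (\<alpha> * p) (\<lambda>u. \<gamma> u powr p))"
  have sub: "dual_lattice s n z \<inter> vecs_upto s d \<subseteq> int_vecs s"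
    using vecs_upto_subset by blast
  have eq: "shifted_prod (rho \<alpha> \<gamma>) x powr p = ?G x" if "x \<in> ?X" for x
  proof -
    obtain h l where x: "x = (h, l)" "h \<in> int_vecs s" "l \<in> int_vecs s"
      using \<open>x \<in> ?X\<close> sub by blast
    show ?thesis
      using rho_powr[OF \<gamma> x(2), of \<alpha> p] rho_powr[OF \<gamma> int_vecs_add[OF x(2,3)], of \<alpha> p]
        rho_pos[OF \<gamma> x(2), of \<alpha>] rho_pos[OF \<gamma> int_vecs_add[OF x(2,3)], of \<alpha>]
      by (simp add: shifted_prod_def x(1) powr_mult)
  qed
  have s: "(\<lambda>x. shifted_prod (rho \<alpha> \<gamma>) x powr p) summable_on ?X"
    by (rule summable_on_cong[OF eq, THEN iffD2, OF _ shifted_rho_summable[OF p(3) weights_powr[OF \<gamma>] sub]])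
  have "T_crit s \<alpha> \<gamma> n d z powr p \<le> (\<Sum>\<^sub>\<infinity>x\<in>?X. shifted_prod (rho \<alpha> \<gamma>) x powr p)"
    unfolding T_crit_eq[OF \<alpha> \<gamma>]
    by (rule infsum_powr_le[OF shifted_rho_summable[OF \<alpha> \<gamma> sub] s _ p(1,2)])
       (rule shifted_rho_nonneg[OF \<gamma>], use sub in blast)
  also have "\<dots> = infsum ?G ?X"
    by (rule infsum_cong[OF eq])
  finally show ?thesis .
qed

text \<open>
  Averaging over the candidates for \<open>z d\<close>: an \<open>l\<close> with \<open>n dvd l d\<close> can occur for all of them,
  any other \<open>l\<close> for at most one.
\<close>

lemma T_crit_powr_le:
  assumes \<alpha>: "\<alpha> > 1" and \<gamma>: "weights \<gamma>" and p: "0 < p" "p \<le> 1" "\<alpha> * p > 1"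
    and n: "prime n" and z: "cbc_vector s \<alpha> \<gamma> n z" and d: "d \<in> {1..s}"
  defines "G \<equiv> shifted_prod (rho (\<alpha> * p) (\<lambda>u. \<gamma> u powr p))"
  shows "T_crit s \<alpha> \<gamma> n d z powr p \<le>
    infsum G (int_vecs s \<times> {l \<in> vecs_upto s d. int n dvd l d}) +
    infsum G (int_vecs s \<times> vecs_upto s d) / (real n - 1)"
proof -
  let ?I = "int_vecs s" and ?V = "vecs_upto s d" and ?N = "{l \<in> vecs_upto s d. int n dvd l d}"
  define D where "D w = dual_lattice s n (z(d := w)) \<inter> ?V" for w
  have n2: "n \<ge> 2" using n by (rule prime_ge_2_nat)
  have Gs: "G summable_on ?I \<times> A" if "A \<subseteq> ?V" for A
    unfolding G_def using that vecs_upto_subset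
    by (intro shifted_rho_summable[OF p(3) weights_powr[OF \<gamma>]]) blast
  have Gn: "0 \<le> G x" if "x \<in> ?I \<times> ?V" for x
    unfolding G_def using that vecs_upto_subset
    by (intro shifted_rho_nonneg[OF weights_powr[OF \<gamma>]]) blast
  have "(real n - 1) * T_crit s \<alpha> \<gamma> n d z powr p = (\<Sum>w\<in>{1..n-1}. T_crit s \<alpha> \<gamma> n d z powr p)"
    using n2 by (simp add: of_nat_diff)
  also have "\<dots> \<le> (\<Sum>w\<in>{1..n-1}. infsum G (?I \<times> D w))"
  proof (rule sum_mono)
    fix w assume w: "w \<in> {1..n-1}"
    have "T_crit s \<alpha> \<gamma> n d z powr p \<le> T_crit s \<alpha> \<gamma> n d (z(d := w)) powr p"
      using z w d p T_crit_nonneg[OF \<alpha> \<gamma>] by (intro powr_mono2) (auto simp: cbc_vector_def)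
    also have "\<dots> \<le> infsum G (?I \<times> D w)"
      unfolding G_def D_def by (rule T_crit_powr_le_aux[OF \<alpha> \<gamma> p])
    finally show "T_crit s \<alpha> \<gamma> n d z powr p \<le> infsum G (?I \<times> D w)" .
  qed
  also have "\<dots> = (\<Sum>w\<in>{1..n-1}. infsum G (?I \<times> (D w \<inter> ?N)) + infsum G (?I \<times> (D w - ?N)))"
  proof (rule sum.cong[OF refl])
    fix w
    have "?I \<times> D w = (?I \<times> (D w \<inter> ?N)) \<union> (?I \<times> (D w - ?N))" by blast
    then show "infsum G (?I \<times> D w) = infsum G (?I \<times> (D w \<inter> ?N)) + infsum G (?I \<times> (D w - ?N))"
      by (simp only:) (rule infsum_Un_disjoint; (rule Gs)?; auto simp: D_def)
  qed
  also have "\<dots> = (\<Sum>w\<in>{1..n-1}. infsum G (?I \<times> (D w \<inter> ?N))) + (\<Sum>w\<in>{1..n-1}. infsum G (?I \<times> (D w - ?N)))"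
    by (rule sum.distrib)
  also have "\<dots> \<le> (\<Sum>w\<in>{1..n-1}. infsum G (?I \<times> ?N)) + infsum G (?I \<times> ?V)"
  proof (rule add_mono)
    show "(\<Sum>w\<in>{1..n-1}. infsum G (?I \<times> (D w \<inter> ?N))) \<le> (\<Sum>w\<in>{1..n-1}. infsum G (?I \<times> ?N))"
      by (intro sum_mono infsum_mono2 Gs Gn) auto
    \<comment> \<open>Outside \<open>?N\<close> the sets for different candidates are disjoint, so
      all \<open>n - 1\<close> sums together form one sum inside \<open>?V\<close>. This gains the
      factor \<open>1 / (n - 1)\<close>.\<close>
    have "(\<Sum>w\<in>{1..n-1}. infsum G (?I \<times> (D w - ?N))) = infsum G (\<Union>w\<in>{1..n-1}. ?I \<times> (D w - ?N))"
    proof (rule sum_infsum)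
      fix w show "G summable_on ?I \<times> (D w - ?N)" by (rule Gs) (auto simp: D_def)
    next
      fix v w assume "v \<in> {1..n-1}" "w \<in> {1..n-1}" "v \<noteq> w"
      from dual_lattice_disjoint[OF n d this] show "?I \<times> (D v - ?N) \<inter> ?I \<times> (D w - ?N) = {}"
        by (auto simp: D_def)
    qed simp
    also have "(\<Union>w\<in>{1..n-1}. ?I \<times> (D w - ?N)) = ?I \<times> (\<Union>w\<in>{1..n-1}. (D w - ?N))" by blast
    also have "infsum G \<dots> \<le> infsum G (?I \<times> ?V)"
      by (intro infsum_mono2 Gs Gn) (auto simp: D_def)
    finally show "(\<Sum>w\<in>{1..n-1}. infsum G (?I \<times> (D w - ?N))) \<le> infsum G (?I \<times> ?V)" .
  qed
  also have "\<dots> = (real n - 1) * infsum G (?I \<times> ?N) + infsum G (?I \<times> ?V)"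
    using n2 by (simp add: of_nat_diff)
  finally show ?thesis
    using n2 by (simp add: field_simps)
qed

text \<open>In the part with \<open>n dvd l d\<close>, one of the two product sums acquires the
  factor \<open>card u\<close> and the other is the plain sum \<open>W0\<close>; both are at most
  \<open>W\<close>. The remaining part is at most \<open>W0\<close> squared over
  \<open>n - 1\<close>. The constant 2 stems from \<open>n - 1 \<ge> n / 2\<close>, and
  \<open>2 * 2 powr (\<alpha> * p)\<close> from the two cases of
  \<open>shifted_rho_congruent_le\<close> and the halved distance there.\<close>

lemma S_crit_powr_le:
  assumes \<alpha>: "\<alpha> > 1" and \<gamma>: "weights \<gamma>" and p: "0 < p" "p \<le> 1" "\<alpha> * p > 1"
    and n: "prime n" and z: "cbc_vector s \<alpha> \<gamma> n z"
  shows "S_crit s \<alpha> \<gamma> n z powr p \<le> (2 + 2 * 2 powr (\<alpha> * p)) / real n *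
    (\<Sum>u\<in>Pow {1..s}. real (max (card u) 1) * \<gamma> u powr p * (2 * zeta (\<alpha> * p)) ^ card u)\<^sup>2"
proof -
  let ?c = "\<alpha> * p" and ?w = "\<lambda>u. \<gamma> u powr p"
  let ?I = "int_vecs s" and ?G = "shifted_prod (rho (\<alpha> * p) (\<lambda>u. \<gamma> u powr p))"
  let ?N = "\<lambda>d. {l \<in> vecs_upto s d. int n dvd l d}"
  define b where "b u = ?w u * (2 * zeta ?c) ^ card u" for u
  define W where "W = (\<Sum>u\<in>Pow {1..s}. real (max (card u) 1) * b u)"
  define W0 where "W0 = infsum (rho ?c ?w) ?I"
  note w = weights_powr[OF \<gamma>, of p]
  have n2: "n \<ge> 2" using n by (rule prime_ge_2_nat)
  have b: "b u \<ge> 0" for u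
    unfolding b_def using zeta_pos[OF p(3)] by simp
  have W0_eq: "W0 = (\<Sum>u\<in>Pow {1..s}. b u)"
    unfolding W0_def b_def by (rule infsumI[OF has_sum_rho[OF p(3)]])
  have W0: "0 \<le> W0" "W0 \<le> W"
    unfolding W0_eq W_def using b mult_right_mono[OF _ b, of 1]
    by (auto intro!: sum_nonneg sum_mono)
  have W: "(\<Sum>u\<in>Pow {1..s}. real (card u) * b u) \<le> W"
    unfolding W_def using b by (intro sum_mono mult_right_mono) auto
  have Gs: "?G summable_on ?I \<times> vecs_upto s d" for d
    by (rule shifted_rho_summable[OF p(3) w vecs_upto_subset])
  \<comment> \<open>Jensen again, for the finite sum over \<open>d\<close> read as an infinite sum
    over a finite index set.\<close>
  have "S_crit s \<alpha> \<gamma> n z powr p \<le> (\<Sum>d=1..s. T_crit s \<alpha> \<gamma> n d z powr p)"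
    using infsum_powr_le[of "\<lambda>d. T_crit s \<alpha> \<gamma> n d z" "{1..s}" p] p T_crit_nonneg[OF \<alpha> \<gamma>]
    by (simp add: S_crit_eq_sum_T_crit[OF \<alpha> \<gamma>])
  also have "\<dots> \<le> (\<Sum>d=1..s. infsum ?G (?I \<times> ?N d) + infsum ?G (?I \<times> vecs_upto s d) / (real n - 1))"
    by (intro sum_mono T_crit_powr_le[OF \<alpha> \<gamma> p n z])
  also have "\<dots> = (\<Sum>d=1..s. infsum ?G (?I \<times> ?N d)) + (\<Sum>d=1..s. infsum ?G (?I \<times> vecs_upto s d)) / (real n - 1)"
    by (simp add: sum.distrib sum_divide_distrib)
  also have "\<dots> \<le> 2 * (2 powr ?c / real n) * W\<^sup>2 + 2 / real n * W\<^sup>2"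
  proof (rule add_mono)
    have "(\<Sum>d=1..s. infsum ?G (?I \<times> ?N d)) \<le>
        (\<Sum>d=1..s. 2 * (2 / real n) powr ?c * W0 * infsum (rho ?c ?w) {k \<in> ?I. k d \<noteq> 0})"
      unfolding W0_def
      by (intro sum_mono shifted_rho_congruent_le[OF w p(3)]) (use n2 in \<open>auto simp: vecs_upto_def\<close>)
    also have "\<dots> = 2 * (2 / real n) powr ?c * W0 * (\<Sum>u\<in>Pow {1..s}. real (card u) * b u)"
      unfolding b_def sum_infsum_rho_ne_zero[OF p(3), symmetric] by (simp only: sum_distrib_left)
    also have "\<dots> \<le> 2 * (2 powr ?c / real n) * W * W"
    proof -
      \<comment> \<open>Since \<open>\<alpha> * p > 1\<close>, the gain in this part is at least a
        factor \<open>1 / n\<close>, the rate of the other part.\<close>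
      have "real n powr 1 \<le> real n powr ?c"
        using n2 p by (intro powr_mono) auto
      then have "(2 / real n) powr ?c \<le> 2 powr ?c / real n"
        using n2 by (simp add: powr_divide divide_left_mono)
      then show ?thesis
        using W0 W b by (intro mult_mono) (auto intro!: sum_nonneg mult_nonneg_nonneg)
    qed
    finally show "(\<Sum>d=1..s. infsum ?G (?I \<times> ?N d)) \<le> 2 * (2 powr ?c / real n) * W\<^sup>2"
      by (simp add: power2_eq_square mult_ac)
  next
    \<comment> \<open>Summing over \<open>d\<close> before estimating avoids a factor
      \<open>s\<close>: the classes are disjoint and lie within the set of all pairs.\<close>
    have "(\<Sum>d=1..s. infsum ?G (?I \<times> vecs_upto s d)) = infsum ?G (\<Union>d\<in>{1..s}. ?I \<times> vecs_upto s d)"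
      by (rule sum_infsum) (use Gs vecs_upto_disjoint in \<open>simp_all add: Times_Int_Times\<close>)
    also have "\<dots> \<le> infsum ?G (?I \<times> ?I)"
    proof (rule infsum_mono2)
      have "(\<Union>d\<in>{1..s}. ?I \<times> vecs_upto s d) = ?I \<times> (\<Union>d\<in>{1..s}. vecs_upto s d)" by blast
      then show "?G summable_on (\<Union>d\<in>{1..s}. ?I \<times> vecs_upto s d)"
        using shifted_rho_summable[OF p(3) w, of "\<Union>d\<in>{1..s}. vecs_upto s d" s] UN_vecs_upto[of s]
        by simp
      show "?G summable_on ?I \<times> ?I" by (rule shifted_rho_summable[OF p(3) w]) auto
    qed (use vecs_upto_subset shifted_rho_nonneg[OF w] in blast)+
    also have "\<dots> = W0\<^sup>2"
      unfolding W0_def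
      by (rule shifted_prod_summable(2)[OF rho_summable[OF p(3)] rho_nonneg[OF w]])
    also have "\<dots> \<le> W\<^sup>2"
      using W0 by (intro power_mono)
    finally have "(\<Sum>d=1..s. infsum ?G (?I \<times> vecs_upto s d)) / (real n - 1) \<le> W\<^sup>2 / (real n / 2)"
      using n2 by (intro frac_le) auto
    then show "(\<Sum>d=1..s. infsum ?G (?I \<times> vecs_upto s d)) / (real n - 1) \<le> 2 / real n * W\<^sup>2"
      by (simp add: mult_ac)
  qed
  also have "\<dots> = (2 + 2 * 2 powr ?c) / real n * W\<^sup>2"
    by (simp add: add_divide_distrib distrib_right)
  finally show ?thesis
    by (simp add: W_def b_def mult_ac)
qed

section \<open>Fourier series on the unit cube\<close>

text \<open>Termwise integration is available for series over the naturals; padding with 0 outside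
  the code set treats finite and infinite \<open>I\<close> alike.\<close>

lemma has_sum_from_nat_into:
  assumes "countable I"
  shows "(f has_sum S) I \<longleftrightarrow>
    ((\<lambda>n. if n \<in> to_nat_on I ` I then f (from_nat_into I n) else 0) has_sum S) UNIV"
proof -
  have "((\<lambda>n. if n \<in> to_nat_on I ` I then f (from_nat_into I n) else 0) has_sum S) UNIV \<longleftrightarrow>
      ((\<lambda>n. f (from_nat_into I n)) has_sum S) (to_nat_on I ` I)"
    by (rule has_sum_cong_neutral) auto
  also have "\<dots> \<longleftrightarrow> (((\<lambda>n. f (from_nat_into I n)) \<circ> to_nat_on I) has_sum S) I"
    by (rule has_sum_reindex) (use assms in auto)
  also have "\<dots> \<longleftrightarrow> (f has_sum S) I"
    by (rule has_sum_cong) (use assms in auto)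
  finally show ?thesis by simp
qed

text \<open>On a finite measure space, summable constants \<open>B i\<close> are an integrable
  majorant. The detour through an enumeration loses nothing: the integrals converge absolutely, so
  their series is also an unordered sum.\<close>

lemma (in finite_measure) has_sum_integral:
  fixes \<phi> :: "'i \<Rightarrow> 'a \<Rightarrow> complex"
  assumes I: "countable I" and meas: "\<And>i. i \<in> I \<Longrightarrow> \<phi> i \<in> borel_measurable M"
    and bound: "\<And>i x. i \<in> I \<Longrightarrow> x \<in> space M \<Longrightarrow> norm (\<phi> i x) \<le> B i"
    and B: "B summable_on I"
    and sum: "\<And>x. x \<in> space M \<Longrightarrow> ((\<lambda>i. \<phi> i x) has_sum F x) I"
  shows "integrable M F" and "((\<lambda>i. integral\<^sup>L M (\<phi> i)) has_sum integral\<^sup>L M F) I"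
proof -
  define J where "J = to_nat_on I ` I"
  define \<psi> where "\<psi> n = (if n \<in> J then \<phi> (from_nat_into I n) else (\<lambda>_. 0))" for n
  define b where "b n = (if n \<in> J then \<bar>B (from_nat_into I n)\<bar> else 0)" for n
  have J: "from_nat_into I n \<in> I" if "n \<in> J" for n
    using that I unfolding J_def by auto
  have "(\<lambda>i. \<bar>B i\<bar>) summable_on I"
    using B by (rule summable_on_iff_abs_summable_on_real[THEN iffD1, unfolded real_norm_def])
  then have "b summable_on UNIV"
    using has_sum_from_nat_into[OF I, of "\<lambda>i. \<bar>B i\<bar>"] unfolding summable_on_def b_def J_def by blast
  then have b: "summable b" by (rule summable_on_imp_summable)
  have \<psi>b: "norm (\<psi> n x) \<le> b n" if "x \<in> space M" for n x
    using bound[OF J that, of n] by (auto simp: \<psi>_def b_def)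
  have \<psi>m: "\<psi> n \<in> borel_measurable M" for n
    using meas[OF J, of n] by (simp add: \<psi>_def)
  have \<psi>i: "integrable M (\<psi> n)" for n
    by (rule integrable_const_bound[where B = "b n"]) (use \<psi>b \<psi>m in auto)
  have s1: "AE x in M. summable (\<lambda>n. norm (\<psi> n x))"
    by (rule AE_I2, rule summable_comparison_test[OF _ b]) (use \<psi>b in auto)
  have "norm (\<integral>x. norm (\<psi> n x) \<partial>M) \<le> b n * measure M (space M)" for n
  proof -
    have "(\<integral>x. norm (\<psi> n x) \<partial>M) \<le> (\<integral>x. b n \<partial>M)"
      by (rule integral_mono) (use \<psi>i \<psi>b in \<open>auto simp: integrable_norm\<close>)
    then show ?thesis by (simp add: mult.commute)
  qed
  then have s2: "summable (\<lambda>n. \<integral>x. norm (\<psi> n x) \<partial>M)"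
    by (intro summable_comparison_test[OF _ summable_mult2[OF b]]) blast
  have F: "(\<Sum>n. \<psi> n x) = F x" if "x \<in> space M" for x
  proof -
    have "((\<lambda>n. \<psi> n x) has_sum F x) UNIV"
      using has_sum_from_nat_into[OF I, THEN iffD1, OF sum[OF that]]
      by (simp add: \<psi>_def J_def if_distrib[of "\<lambda>f. f x"])
    then show ?thesis by (metis has_sum_imp_sums sums_unique)
  qed
  show "integrable M F"
    using integrable_suminf[OF \<psi>i s1 s2] F by (simp cong: Bochner_Integration.integrable_cong)
  have "(\<lambda>n. integral\<^sup>L M (\<psi> n)) sums (\<integral>x. (\<Sum>n. \<psi> n x) \<partial>M)"
    by (rule sums_integral[OF \<psi>i s1 s2])
  also have "(\<integral>x. (\<Sum>n. \<psi> n x) \<partial>M) = integral\<^sup>L M F"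
    by (rule Bochner_Integration.integral_cong) (use F in auto)
  finally have sums: "(\<lambda>n. integral\<^sup>L M (\<psi> n)) sums integral\<^sup>L M F" .
  have "summable (\<lambda>n. norm (integral\<^sup>L M (\<psi> n)))"
    by (rule summable_comparison_test[OF _ s2]) auto
  from norm_summable_imp_has_sum[OF this sums]
  have "((\<lambda>n. integral\<^sup>L M (\<psi> n)) has_sum integral\<^sup>L M F) UNIV" .
  moreover have "(\<lambda>n. integral\<^sup>L M (\<psi> n)) =
      (\<lambda>n. if n \<in> to_nat_on I ` I then integral\<^sup>L M (\<phi> (from_nat_into I n)) else 0)"
    by (auto simp: \<psi>_def J_def)
  ultimately show "((\<lambda>i. integral\<^sup>L M (\<phi> i)) has_sum integral\<^sup>L M F) I"
    using has_sum_from_nat_into[OF I, of "\<lambda>i. integral\<^sup>L M (\<phi> i)"] by simp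
qed

lemma countable_int_vecs: "countable (int_vecs s)"
proof (rule countable_image_inj_on)
  show "inj_on (\<lambda>h. restrict h {1..s}) (int_vecs s)"
    by (auto simp: inj_on_def int_vecs_def fun_eq_iff restrict_def) metis
  have "(\<lambda>h. restrict h {1..s}) ` int_vecs s \<subseteq> PiE {1..s} (\<lambda>_. UNIV)" by auto
  then show "countable ((\<lambda>h. restrict h {1..s}) ` int_vecs s)"
    by (rule countable_subset) (intro countable_PiE; simp)
qed

section \<open>Characters of the torus\<close>

lemma fourier_char_cis: "fourier_char s h x = cis (2 * pi * (\<Sum>j=1..s. real_of_int (h j) * x j))"
  unfolding fourier_char_def cis_conv_exp by (rule arg_cong[where f = exp]) simp

lemma norm_fourier_char [simp]: "norm (fourier_char s h x) = 1"
  by (simp add: fourier_char_cis)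

lemma fourier_char_0 [simp]: "fourier_char s (\<lambda>_. 0) x = 1"
  by (simp add: fourier_char_cis)

lemma fourier_char_diff: "fourier_char s (\<lambda>j. h j - k j) x = fourier_char s h x * cnj (fourier_char s k x)"
  by (simp add: fourier_char_cis cis_mult cis_cnj sum_subtractf algebra_simps)

lemma fourier_char_minus_point: "fourier_char s h (\<lambda>j. x j - y j) = fourier_char s h x * cnj (fourier_char s h y)"
  by (simp add: fourier_char_cis cis_mult cis_cnj sum_subtractf algebra_simps)

lemma cis_sum: "finite A \<Longrightarrow> cis (sum f A) = (\<Prod>j\<in>A. cis (f j))"
  by (induction A rule: finite_induct) (auto simp: cis_mult[symmetric])

lemma fourier_char_prod: "fourier_char s h x = (\<Prod>j=1..s. cis (2 * pi * (real_of_int (h j) * x j)))"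
  by (simp add: fourier_char_cis sum_distrib_left cis_sum)

lemma fourier_char_prod_supp:
  assumes "h \<in> int_vecs s"
  shows "fourier_char s h x = (\<Prod>j\<in>supp h. cis (2 * pi * (real_of_int (h j) * x j)))"
  unfolding fourier_char_prod
  by (rule prod.mono_neutral_right) (use supp_subset[OF assms] in \<open>auto simp: supp_def\<close>)

abbreviation unit_interval :: "real measure" where
  "unit_interval \<equiv> restrict_space lborel {0..1}"

lemma prob_space_unit_interval: "prob_space unit_interval"
  by (rule prob_spaceI) (simp add: emeasure_restrict_space space_restrict_space)

lemma unit_cube_product: "product_sigma_finite (\<lambda>_::nat. unit_interval)"
proof -
  interpret prob_space unit_interval by (rule prob_space_unit_interval)
  show ?thesis by standard
qed

lemma prob_space_unit_cube: "prob_space (unit_cube s)"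
  unfolding unit_cube_def by (rule prob_space_PiM) (rule prob_space_unit_interval)

lemma space_unit_cube: "space (unit_cube s) = {1..s} \<rightarrow>\<^sub>E {0..1}"
  by (simp add: unit_cube_def space_PiM space_restrict_space)

lemma unit_cube_PiE: "x \<in> space (unit_cube s) \<Longrightarrow> x \<in> {1..s} \<rightarrow>\<^sub>E UNIV"
  by (auto simp: space_unit_cube)

lemma integrable_cis_unit_interval: "integrable unit_interval (\<lambda>x. cis (a * x))"
proof -
  interpret prob_space unit_interval by (rule prob_space_unit_interval)
  have "(\<lambda>x. cis (a * x)) \<in> borel_measurable borel"
    by (intro borel_measurable_continuous_onI continuous_intros)
  then have "(\<lambda>x. cis (a * x)) \<in> borel_measurable unit_interval"
    by (simp add: measurable_restrict_space1)
  then show ?thesis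
    by (rule integrable_const_bound[where B = 1, rotated]) auto
qed

lemma integral_cis_unit_interval:
  fixes m :: int
  shows "(\<integral>x. cis (2 * pi * (real_of_int m * x)) \<partial>unit_interval) = (if m = 0 then 1 else 0)"
proof (cases "m = 0")
  case True
  interpret prob_space unit_interval by (rule prob_space_unit_interval)
  show ?thesis using True prob_space by simp
next
  case False
  define a where "a = 2 * pi * real_of_int m"
  have a: "a \<noteq> 0" using False by (simp add: a_def)
  define F where "F x = cis (a * x) / (\<i> * of_real a)" for x
  have "(F has_vector_derivative cis (a * x)) (at x within A)" for x A
  proof -
    have "((\<lambda>z. exp (\<i> * of_real a * z) / (\<i> * of_real a)) has_field_derivative exp (\<i> * of_real a * of_real x))
        (at (of_real x))"
      using a by (auto intro!: derivative_eq_intros)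
    from has_vector_derivative_real_field[OF this] show ?thesis
      by (simp add: F_def[abs_def] cis_conv_exp mult.assoc)
  qed
  then have "(\<integral>x. indicator {0..1} x *\<^sub>R cis (a * x) \<partial>lborel) = F 1 - F 0"
    by (intro integral_FTC_Icc continuous_intros) auto
  also have "F 1 - F 0 = 0"
    by (simp add: F_def a_def)
  finally have "(\<integral>x. indicator {0..1} x *\<^sub>R cis (a * x) \<partial>lborel) = 0" .
  then show ?thesis
    using False by (simp add: integral_restrict_space a_def mult.assoc)
qed

lemma fourier_char_measurable [measurable]: "fourier_char s h \<in> borel_measurable (unit_cube s)"
proof -
  have "(\<lambda>x. x j) \<in> borel_measurable (unit_cube s)" if "j \<in> {1..s}" for j
  proof -
    have "(\<lambda>x. x j) \<in> measurable (unit_cube s) unit_interval"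
      unfolding unit_cube_def using that by (rule measurable_component_singleton)
    moreover have "(\<lambda>x. x) \<in> borel_measurable unit_interval"
      by (simp add: measurable_restrict_space1)
    ultimately show ?thesis by (rule measurable_compose[of _ _ unit_interval])
  qed
  then have "(\<lambda>x. \<Sum>j=1..s. real_of_int (h j) * x j) \<in> borel_measurable (unit_cube s)"
    by (intro borel_measurable_sum borel_measurable_times) auto
  moreover have "(\<lambda>t. cis (2 * pi * t)) \<in> borel_measurable borel"
    by (intro borel_measurable_continuous_onI continuous_intros)
  ultimately have "(\<lambda>x. cis (2 * pi * (\<Sum>j=1..s. real_of_int (h j) * x j))) \<in> borel_measurable (unit_cube s)"
    by (rule measurable_compose)
  then show ?thesis by (simp add: fourier_char_cis[abs_def])
qed

lemma integral_fourier_char: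
  assumes "h \<in> int_vecs s"
  shows "(\<integral>x. fourier_char s h x \<partial>unit_cube s) = (if h = (\<lambda>_. 0) then 1 else 0)"
proof -
  interpret P: product_sigma_finite "\<lambda>_::nat. unit_interval" by (rule unit_cube_product)
  have "(\<integral>x. fourier_char s h x \<partial>unit_cube s) =
      (\<Prod>j=1..s. \<integral>x. cis (2 * pi * (real_of_int (h j) * x)) \<partial>unit_interval)"
    unfolding fourier_char_prod unit_cube_def
    by (rule P.product_integral_prod) (use integrable_cis_unit_interval in \<open>auto simp: mult.assoc[symmetric]\<close>)
  also have "\<dots> = (\<Prod>j=1..s. if h j = 0 then 1 else 0)"
    by (simp only: integral_cis_unit_interval)
  also have "\<dots> = (if h = (\<lambda>_. 0) then 1 else 0)"
  proof (cases "h = (\<lambda>_. 0)")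
    case False
    then obtain j where "h j \<noteq> 0" by auto
    then have "j \<in> {1..s}" using assms by (auto simp: int_vecs_def)
    then have "(\<Prod>j=1..s. if h j = 0 then 1 else (0::complex)) = 0"
      using \<open>h j \<noteq> 0\<close> by (intro prod_zero) auto
    then show ?thesis using False by simp
  qed auto
  finally show ?thesis .
qed

section \<open>Absolutely convergent Fourier series\<close>

lemma integrable_fourier_series:
  fixes g :: "(nat \<Rightarrow> real) \<Rightarrow> real"
  assumes c: "(\<lambda>h. norm (c h)) summable_on int_vecs s"
    and g: "\<And>x. x \<in> space (unit_cube s) \<Longrightarrow> ((\<lambda>h. c h * fourier_char s h x) has_sum of_real (g x)) (int_vecs s)"
  shows "integrable (unit_cube s) g"
proof -
  interpret prob_space "unit_cube s" by (rule prob_space_unit_cube)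
  have "integrable (unit_cube s) (\<lambda>x. complex_of_real (g x))"
    by (rule has_sum_integral(1)[OF countable_int_vecs _ _ c g]) (auto simp: norm_mult)
  from integrable_Re[OF this] show ?thesis by simp
qed

text \<open>An absolutely convergent series determines its coefficients: times a conjugate character
  it can be integrated termwise, and orthogonality keeps one term.\<close>

lemma fourier_coeff_series:
  assumes c: "(\<lambda>h. norm (c h)) summable_on int_vecs s"
    and g: "\<And>x. x \<in> space (unit_cube s) \<Longrightarrow> ((\<lambda>h. c h * fourier_char s h x) has_sum of_real (g x)) (int_vecs s)"
    and k: "k \<in> int_vecs s"
  shows "fourier_coeff s g k = c k"
proof -
  interpret prob_space "unit_cube s" by (rule prob_space_unit_cube)
  have sum: "((\<lambda>h. c h * fourier_char s (\<lambda>j. h j - k j) x) has_sum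
      of_real (g x) * cnj (fourier_char s k x)) (int_vecs s)" if "x \<in> space (unit_cube s)" for x
    using has_sum_cmult_left[OF g[OF that], of "cnj (fourier_char s k x)"]
    by (simp add: fourier_char_diff mult.assoc)
  have "((\<lambda>h. \<integral>x. c h * fourier_char s (\<lambda>j. h j - k j) x \<partial>unit_cube s) has_sum fourier_coeff s g k) (int_vecs s)"
    unfolding fourier_coeff_def
    by (rule has_sum_integral(2)[OF countable_int_vecs _ _ c sum]) (auto simp: norm_mult)
  moreover have "((\<lambda>h. \<integral>x. c h * fourier_char s (\<lambda>j. h j - k j) x \<partial>unit_cube s) has_sum c k) (int_vecs s)"
  proof -
    have "(\<integral>x. c h * fourier_char s (\<lambda>j. h j - k j) x \<partial>unit_cube s) = (if h = k then c k else 0)"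
      if "h \<in> int_vecs s" for h
    proof -
      have "(\<lambda>j. h j - k j) = (\<lambda>_. 0) \<longleftrightarrow> h = k" by (simp add: fun_eq_iff)
      then show ?thesis using integral_fourier_char[OF int_vecs_diff[OF that k]] by simp
    qed
    then show ?thesis
      by (intro has_sum_finite_neutralI[where B = "{k}"]) (use k in \<open>simp_all add: prob_space\<close>)
  qed
  ultimately show ?thesis using has_sum_unique by blast
qed

lemma Parseval:
  fixes g :: "(nat \<Rightarrow> real) \<Rightarrow> real"
  assumes c: "(\<lambda>h. norm (c h)) summable_on int_vecs s"
    and g: "\<And>x. x \<in> space (unit_cube s) \<Longrightarrow> ((\<lambda>h. c h * fourier_char s h x) has_sum of_real (g x)) (int_vecs s)"
  shows "((\<lambda>h. (norm (c h))\<^sup>2) has_sum (\<integral>x. (g x)\<^sup>2 \<partial>unit_cube s)) (int_vecs s)"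
proof -
  interpret prob_space "unit_cube s" by (rule prob_space_unit_cube)
  have int: "integrable (unit_cube s) g" by (rule integrable_fourier_series[OF c g])
  define B where "B = (\<Sum>\<^sub>\<infinity>h\<in>int_vecs s. norm (c h))"
  have gB: "\<bar>g x\<bar> \<le> B" if "x \<in> space (unit_cube s)" for x
    using norm_has_sum_bound[OF _ g[OF that]] c unfolding B_def
    by (simp add: norm_mult)
  \<comment> \<open>This is the conjugated series of \<open>g\<close> times the real number
    \<open>g x\<close>. Integrated, the term at \<open>h\<close> contains the Fourier coefficient of
    \<open>g\<close>, which is \<open>c h\<close> again; the bound \<open>B\<close> on
    \<open>g\<close> supplies the majorant.\<close>
  have sum: "((\<lambda>h. cnj (c h) * (of_real (g x) * cnj (fourier_char s h x))) has_sum of_real ((g x)\<^sup>2)) (int_vecs s)"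
    if "x \<in> space (unit_cube s)" for x
    using has_sum_cmult_right[OF has_sum_cnj_iff[THEN iffD2, OF g[OF that]], of "of_real (g x)"]
    by (simp add: power2_eq_square mult_ac)
  have "((\<lambda>h. \<integral>x. cnj (c h) * (of_real (g x) * cnj (fourier_char s h x)) \<partial>unit_cube s) has_sum
      (\<integral>x. of_real ((g x)\<^sup>2) \<partial>unit_cube s)) (int_vecs s)"
  proof (rule has_sum_integral(2)[OF countable_int_vecs _ _ _ sum])
    show "(\<lambda>h. norm (c h) * B) summable_on int_vecs s" by (rule summable_on_cmult_left[OF c])
    show "(\<lambda>x. cnj (c h) * (of_real (g x) * cnj (fourier_char s h x))) \<in> borel_measurable (unit_cube s)" for h
      using borel_measurable_integrable[OF int]
      by (intro borel_measurable_times borel_measurable_of_real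
          borel_measurable_continuous_on[where f = cnj] continuous_intros) simp_all
    show "norm (cnj (c h) * (of_real (g x) * cnj (fourier_char s h x))) \<le> norm (c h) * B"
      if "x \<in> space (unit_cube s)" for h x
      using gB[OF that] by (simp add: norm_mult mult_left_mono)
  qed
  moreover have "(\<integral>x. cnj (c h) * (of_real (g x) * cnj (fourier_char s h x)) \<partial>unit_cube s) = of_real ((norm (c h))\<^sup>2)"
    if "h \<in> int_vecs s" for h
  proof -
    have "(\<integral>x. cnj (c h) * (of_real (g x) * cnj (fourier_char s h x)) \<partial>unit_cube s) =
        cnj (c h) * fourier_coeff s g h"
      by (simp add: fourier_coeff_def)
    also have "\<dots> = of_real ((norm (c h))\<^sup>2)"
      using fourier_coeff_series[of c s g h, OF c g that] by (simp only: mult.commute complex_norm_square)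
    finally show ?thesis .
  qed
  ultimately have "((\<lambda>h. complex_of_real ((norm (c h))\<^sup>2)) has_sum of_real (\<integral>x. (g x)\<^sup>2 \<partial>unit_cube s)) (int_vecs s)"
    by (subst (asm) has_sum_cong) (auto simp only: integral_complex_of_real)
  then show ?thesis by (simp only: has_sum_of_real_iff)
qed

section \<open>The kernel and its Fourier series\<close>

text \<open>Conjugation exchanges the terms at \<open>m\<close> and \<open>- m\<close>, so the real
  part taken in \<open>eta\<close> discards nothing.\<close>

lemma of_real_eta:
  assumes "\<alpha> > 1"
  shows "of_real (eta \<alpha> y) =
    (\<Sum>\<^sub>\<infinity>m\<in>UNIV - {0}. of_real (\<bar>real_of_int m\<bar> powr - \<alpha>) * cis (2 * pi * (real_of_int m * y)))"
proof -
  define f where "f m = of_real (\<bar>real_of_int m\<bar> powr - \<alpha>) * cis (2 * pi * (real_of_int m * y))" for m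
  have "cnj (infsum f (UNIV - {0})) = (\<Sum>\<^sub>\<infinity>m\<in>UNIV - {0}. cnj (f m))"
    by (rule infsum_cnj[symmetric])
  also have "\<dots> = (\<Sum>\<^sub>\<infinity>m\<in>UNIV - {0}. f (- m))"
    by (rule infsum_cong) (simp add: f_def cis_cnj)
  also have "\<dots> = infsum f (UNIV - {0})"
    by (rule infsum_reindex_bij_betw[where g = uminus]) (rule bij_betwI[where g = uminus], auto)
  finally have "infsum f (UNIV - {0}) \<in> \<real>"
    by (rule Reals_cnj_iff[THEN iffD2])
  moreover have "eta \<alpha> y = Re (infsum f (UNIV - {0}))"
    unfolding eta_def f_def
    by (intro arg_cong[where f = Re] infsum_cong) (simp add: cis_conv_exp mult_ac)
  ultimately show ?thesis
    by (simp add: f_def[abs_def])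
qed

text \<open>The kernel has Fourier coefficients \<open>1 / r\<close>: the sum over subsets in the
  definition of \<open>kernel\<close> is what grouping the series by support produces.\<close>

lemma kernel_has_sum:
  assumes "\<alpha> > 1"
  shows "((\<lambda>h. of_real (rho \<alpha> \<gamma> h) * (fourier_char s h x * cnj (fourier_char s h y))) has_sum
    of_real (kernel s \<alpha> \<gamma> x y)) (int_vecs s)"
proof -
  let ?\<phi> = "\<lambda>j m. complex_of_real (\<bar>real_of_int m\<bar> powr - \<alpha>) * cis (2 * pi * (real_of_int m * (x j - y j)))"
  have *: "(\<lambda>m. norm (?\<phi> j m)) summable_on UNIV - {0}" for j
    using has_sum_zeta[OF assms] by (simp add: has_sum_imp_summable norm_mult)
  have "((\<lambda>h. of_real (\<gamma> (supp h)) * (\<Prod>j\<in>supp h. ?\<phi> j (h j))) has_sum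
      (\<Sum>u\<in>Pow {1..s}. of_real (\<gamma> u) * (\<Prod>j\<in>u. infsum (?\<phi> j) (UNIV - {0})))) (int_vecs s)"
    by (rule has_sum_int_vecs_prod[of s ?\<phi> "\<lambda>u. of_real (\<gamma> u)", OF *])
  also have "(\<Sum>u\<in>Pow {1..s}. of_real (\<gamma> u) * (\<Prod>j\<in>u. infsum (?\<phi> j) (UNIV - {0}))) =
      complex_of_real (kernel s \<alpha> \<gamma> x y)"
    by (simp add: kernel_def flip: of_real_eta[OF assms])
  finally show ?thesis
  proof (rule has_sum_cong[THEN iffD1, rotated])
    fix h assume h: "h \<in> int_vecs s"
    show "of_real (\<gamma> (supp h)) * (\<Prod>j\<in>supp h. ?\<phi> j (h j)) =
        of_real (rho \<alpha> \<gamma> h) * (fourier_char s h x * cnj (fourier_char s h y))"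
      unfolding fourier_char_minus_point[symmetric]
      unfolding fourier_char_prod_supp[OF h] rho_def by (simp add: prod.distrib)
  qed
qed

section \<open>Characters at the lattice points\<close>

lemma cis_eq_1_iff: "cis (2 * pi * t) = 1 \<longleftrightarrow> t \<in> \<int>"
proof
  assume "cis (2 * pi * t) = 1"
  then have "cos (2 * pi * t) = 1" by (metis cis.sel(1) one_complex.sel(1))
  then obtain m :: int where "2 * pi * t = real_of_int m * 2 * pi" unfolding cos_one_2pi_int by blast
  then have "t = m" by simp
  then show "t \<in> \<int>" by simp
qed simp

lemma cis_periodic: "k \<in> \<int> \<Longrightarrow> cis (2 * pi * (t - k)) = cis (2 * pi * t)"
proof -
  assume "k \<in> \<int>"
  then have "cis (2 * pi * k) = 1" by simp
  moreover have "cis (2 * pi * t) = cis (2 * pi * (t - k)) * cis (2 * pi * k)"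
    unfolding cis_mult by (rule arg_cong[where f = cis]) (simp add: algebra_simps)
  ultimately show ?thesis by simp
qed

definition unit_root :: "nat \<Rightarrow> int \<Rightarrow> complex" where
  "unit_root n m = cis (2 * pi * (real_of_int m / real n))"

lemma unit_root_add: "unit_root n (a + b) = unit_root n a * unit_root n b"
  by (simp add: unit_root_def cis_mult add_divide_distrib distrib_left)

lemma unit_root_diff: "unit_root n (a - b) = unit_root n a * cnj (unit_root n b)"
  by (simp add: unit_root_def cis_cnj cis_mult diff_divide_distrib right_diff_distrib)

lemma unit_root_power: "unit_root n (int k * a) = unit_root n a ^ k"
  unfolding unit_root_def unfolding Complex.DeMoivre by (rule arg_cong[where f = cis]) simp

lemma unit_root_eq_1_iff:
  assumes "n > 0"
  shows "unit_root n m = 1 \<longleftrightarrow> int n dvd m"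
proof -
  have "real_of_int m / real n \<in> \<int> \<longleftrightarrow> int n dvd m"
  proof
    assume "real_of_int m / real n \<in> \<int>"
    then obtain k :: int where "real_of_int m / real n = k" by (elim Ints_cases)
    then have "real_of_int m = real_of_int (int n * k)" using assms by (simp add: field_simps)
    then have "m = int n * k" by (simp only: of_int_eq_iff)
    then show "int n dvd m" by simp
  next
    assume "int n dvd m"
    then obtain k where "m = int n * k" by (elim dvdE)
    then show "real_of_int m / real n \<in> \<int>" using assms by simp
  qed
  then show ?thesis unfolding unit_root_def cis_eq_1_iff .
qed

lemma sum_unit_root:
  assumes "n > 0"
  shows "(\<Sum>k=1..n. unit_root n (int k * m)) = (if int n dvd m then of_nat n else 0)"
proof (cases "int n dvd m")
  case True
  then have "unit_root n m = 1" using unit_root_eq_1_iff[OF assms] by blast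
  then show ?thesis using True by (simp add: unit_root_power)
next
  case False
  then have ne: "unit_root n m \<noteq> 1" using unit_root_eq_1_iff[OF assms] by blast
  have "unit_root n m ^ n = 1"
    unfolding unit_root_power[symmetric] using unit_root_eq_1_iff[OF assms] by simp
  \<comment> \<open>Starting at 1 instead of 0 only multiplies the geometric sum, which is 0 here,
    by the root.\<close>
  moreover have "(\<Sum>k=1..n. unit_root n (int k * m)) = unit_root n m * (\<Sum>k<n. unit_root n m ^ k)"
    unfolding unit_root_power sum_distrib_left
    by (rule sum.reindex_bij_witness[of _ Suc "\<lambda>k. k - 1"]) (auto simp flip: power_Suc)
  ultimately show ?thesis using False ne by (simp add: geometric_sum)
qed

definition dot :: "nat \<Rightarrow> (nat \<Rightarrow> nat) \<Rightarrow> (nat \<Rightarrow> int) \<Rightarrow> int" where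
  "dot s z h = (\<Sum>j=1..s. h j * int (z j))"

lemma dual_lattice_iff: "l \<in> dual_lattice s n z \<longleftrightarrow> l \<in> int_vecs s \<and> int n dvd dot s z l"
  by (simp add: dual_lattice_def dot_def cong_0_iff)

lemma dot_diff: "dot s z (\<lambda>j. h j - l j) = dot s z h - dot s z l"
  by (simp add: dot_def sum_subtractf left_diff_distrib)

lemma lattice_point_PiE: "lattice_point s n z k \<in> {1..s} \<rightarrow>\<^sub>E UNIV"
  by (simp add: lattice_point_def)

lemma fourier_char_lattice:
  "fourier_char s h (lattice_point s n z k) = unit_root n (int k * dot s z h)"
proof -
  \<comment> \<open>\<open>K\<close> collects the integer parts removed by \<open>frac\<close>; it
    is an integer and so does not affect the character.\<close>
  define K where "K = (\<Sum>j=1..s. real_of_int (h j) * of_int \<lfloor>real k * real (z j) / real n\<rfloor>)"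
  have "(\<Sum>j=1..s. real_of_int (h j) * lattice_point s n z k j) =
      (\<Sum>j=1..s. real_of_int (h j) * (real k * real (z j) / real n)) - K"
    unfolding K_def sum_subtractf[symmetric]
    by (rule sum.cong) (auto simp: lattice_point_def frac_def algebra_simps)
  also have "(\<Sum>j=1..s. real_of_int (h j) * (real k * real (z j) / real n)) =
      real_of_int (int k * dot s z h) / real n"
    by (simp add: dot_def sum_distrib_left sum_divide_distrib mult_ac)
  finally have "fourier_char s h (lattice_point s n z k) =
      cis (2 * pi * (real_of_int (int k * dot s z h) / real n - K))"
    by (simp only: fourier_char_cis)
  also have "\<dots> = unit_root n (int k * dot s z h)"
    unfolding unit_root_def by (rule cis_periodic) (auto simp: K_def)
  finally show ?thesis .
qed

section \<open>Functions vanishing at the lattice points\<close>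

text \<open>
  Testing the values at the lattice points against a character aliases the coefficients along
  the dual lattice.
\<close>

lemma has_sum_dual_lattice:
  assumes n: "n > 0" and h: "h \<in> int_vecs s"
    and zero: "\<And>k. k \<in> {1..n} \<Longrightarrow>
      ((\<lambda>m. c m * fourier_char s m (lattice_point s n z k)) has_sum 0) (int_vecs s)"
  shows "((\<lambda>l. c (\<lambda>j. h j + l j)) has_sum (- c h)) (dual_lattice s n z - {\<lambda>_. 0})"
proof -
  let ?I = "int_vecs s"
  have "((\<lambda>m. \<Sum>k=1..n. cnj (unit_root n (int k * dot s z h)) * (c m * fourier_char s m (lattice_point s n z k)))
      has_sum (\<Sum>k=1..n. cnj (unit_root n (int k * dot s z h)) * 0)) ?I"
    by (intro has_sum_sum has_sum_cmult_right zero)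
  also have "(\<Sum>k=1..n. cnj (unit_root n (int k * dot s z h)) * 0) = 0" by simp
  finally have "((\<lambda>m. if int n dvd dot s z m - dot s z h then of_nat n * c m else 0) has_sum 0) ?I"
  proof (rule has_sum_cong[THEN iffD1, rotated])
    fix m
    have "(\<Sum>k=1..n. cnj (unit_root n (int k * dot s z h)) * (c m * fourier_char s m (lattice_point s n z k))) =
        c m * (\<Sum>k=1..n. unit_root n (int k * (dot s z m - dot s z h)))"
      unfolding fourier_char_lattice sum_distrib_left
      by (simp add: right_diff_distrib unit_root_diff mult_ac)
    also have "\<dots> = (if int n dvd dot s z m - dot s z h then of_nat n * c m else 0)"
      unfolding sum_unit_root[OF n] by simp
    finally show "(\<Sum>k=1..n. cnj (unit_root n (int k * dot s z h)) * (c m * fourier_char s m (lattice_point s n z k))) =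
        (if int n dvd dot s z m - dot s z h then of_nat n * c m else 0)" .
  qed
  from has_sum_cmult_right[OF this, of "1 / of_nat n"]
  have "((\<lambda>m. if int n dvd dot s z m - dot s z h then c m else 0) has_sum 0) ?I"
    using n by (simp add: if_distrib[of "\<lambda>x. _ * x"] cong: if_cong)
  then have "(c has_sum 0) {m \<in> ?I. int n dvd dot s z m - dot s z h}"
    by (rule has_sum_cong_neutral[THEN iffD1, rotated 3]) auto
  also have "?this \<longleftrightarrow> ((\<lambda>l. c (\<lambda>j. h j + l j)) has_sum 0) (dual_lattice s n z)"
  proof (rule has_sum_reindex_bij_betw[symmetric])
    show "bij_betw (\<lambda>l j. h j + l j) (dual_lattice s n z) {m \<in> ?I. int n dvd dot s z m - dot s z h}"
      by (rule bij_betwI[where g = "\<lambda>m j. m j - h j"])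
         (use h in \<open>auto simp: dual_lattice_iff int_vecs_def dot_diff dot_def sum.distrib distrib_right\<close>)
  qed
  \<comment> \<open>The sum over the whole coset is 0; taking out \<open>l = 0\<close> leaves minus
    that coefficient.\<close>
  finally have "((\<lambda>l. c (\<lambda>j. h j + l j)) has_sum 0 - c (\<lambda>j. h j + 0)) (dual_lattice s n z - {\<lambda>_. 0})"
  proof (rule has_sum_Diff)
    show "((\<lambda>l. c (\<lambda>j. h j + l j)) has_sum c (\<lambda>j. h j + 0)) {\<lambda>_. 0}"
      by (rule has_sum_finiteI) auto
    show "{\<lambda>_. 0} \<subseteq> dual_lattice s n z"
      by (auto simp: dual_lattice_iff int_vecs_def dot_def)
  qed
  then show ?thesis by simp
qed

lemma r_rho: "weights \<gamma> \<Longrightarrow> h \<in> int_vecs s \<Longrightarrow> r \<alpha> \<gamma> h * rho \<alpha> \<gamma> h = 1"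
  using r_pos[of \<gamma> h s \<alpha>] by (simp flip: inverse_r)

lemma L2_norm_le:
  assumes \<alpha>: "\<alpha> > 1" and \<gamma>: "weights \<gamma>" and n: "n > 0"
    and c: "(\<lambda>h. norm (c h)) summable_on int_vecs s"
    and g: "\<And>x. x \<in> {1..s} \<rightarrow>\<^sub>E UNIV \<Longrightarrow> ((\<lambda>h. c h * fourier_char s h x) has_sum of_real (g x)) (int_vecs s)"
    and rc: "(\<lambda>h. r \<alpha> \<gamma> h * (norm (c h))\<^sup>2) summable_on int_vecs s"
    and rc1: "(\<Sum>\<^sub>\<infinity>h\<in>int_vecs s. r \<alpha> \<gamma> h * (norm (c h))\<^sup>2) \<le> 1"
    and g0: "\<And>k. k \<in> {1..n} \<Longrightarrow> g (lattice_point s n z k) = 0"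
  shows "L2_norm s g \<le> S_crit s \<alpha> \<gamma> n z powr (1 / 4)"
proof -
  let ?I = "int_vecs s" and ?L = "dual_lattice s n z - {\<lambda>_. 0}" and ?\<rho> = "rho \<alpha> \<gamma>"
  \<comment> \<open>\<open>norm (c h)\<close> factors as \<open>q h * t h\<close>, where the squares
    of \<open>q\<close> are the terms of the squared \<open>H_norm\<close> and those of
    \<open>t\<close> are \<open>1 / r\<close>.\<close>
  define q where "q h = sqrt (r \<alpha> \<gamma> h) * norm (c h)" for h
  define t where "t h = sqrt (?\<rho> h)" for h
  have L: "?L \<subseteq> ?I" by (auto simp: dual_lattice_def)
  have r0: "r \<alpha> \<gamma> h > 0" and \<rho>0: "?\<rho> h > 0" if "h \<in> ?I" for h
    using r_pos[OF \<gamma> that] rho_pos[OF \<gamma> that] by auto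
  have q2: "(q h)\<^sup>2 = r \<alpha> \<gamma> h * (norm (c h))\<^sup>2" if "h \<in> ?I" for h
    using r0[OF that] by (simp add: q_def power_mult_distrib)
  have t2: "(t h)\<^sup>2 = ?\<rho> h" if "h \<in> ?I" for h
    using \<rho>0[OF that] by (simp add: t_def)
  have qt: "norm (c h) = q h * t h" if "h \<in> ?I" for h
    using r_rho[OF \<gamma> that, of \<alpha>]
    by (simp add: q_def t_def mult.assoc mult.left_commute[of _ "norm (c h)"] flip: real_sqrt_mult)
  have q0: "q h \<ge> 0" and t0: "t h \<ge> 0" if "h \<in> ?I" for h
    using r0[OF that] \<rho>0[OF that] by (auto simp: q_def t_def)
  have qs: "(\<lambda>h. (q h)\<^sup>2) summable_on ?I" "(\<Sum>\<^sub>\<infinity>h\<in>?I. (q h)\<^sup>2) \<le> 1"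
    using rc rc1 q2 by (simp_all cong: summable_on_cong infsum_cong)
  have ts: "(\<lambda>h. (t h)\<^sup>2) summable_on ?I"
    using rho_summable[OF \<alpha>, of \<gamma> s] t2 by (simp cong: summable_on_cong)
  define Q where "Q h = (\<Sum>\<^sub>\<infinity>l\<in>?L. ?\<rho> (\<lambda>j. h j + l j))" for h
  have shift: "inj_on (\<lambda>l j. h j + l j) ?L" "(\<lambda>l j. h j + l j) ` ?L \<subseteq> ?I" if "h \<in> ?I" for h
    using int_vecs_add[OF that] L by (auto simp: inj_on_def fun_eq_iff)
  have cQ: "(norm (c h))\<^sup>2 \<le> Q h" if h: "h \<in> ?I" for h
  proof -
    let ?h = "\<lambda>l j. h j + l j"
    have hl: "?h l \<in> ?I" if "l \<in> ?L" for l using shift(2)[OF h] that by blast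
    \<comment> \<open>For fixed \<open>h\<close> the shifted vectors are distinct, so the shifted
      squares of \<open>q\<close> are part of the full sum and add up to at most 1; those of
      \<open>t\<close> add up to \<open>Q h\<close>.\<close>
    note sq = infsum_le_inj[OF shift[OF h], where f = "\<lambda>l. (q (?h l))\<^sup>2" and g = "\<lambda>h. (q h)\<^sup>2", OF _ _ qs(1)]
    note st = infsum_le_inj[OF shift[OF h], where f = "\<lambda>l. (t (?h l))\<^sup>2" and g = "\<lambda>h. (t h)\<^sup>2", OF _ _ ts]
    have CS: "(\<lambda>l. q (?h l) * t (?h l)) summable_on ?L"
      "(\<Sum>\<^sub>\<infinity>l\<in>?L. q (?h l) * t (?h l)) \<le> sqrt (\<Sum>\<^sub>\<infinity>l\<in>?L. (q (?h l))\<^sup>2) * sqrt (\<Sum>\<^sub>\<infinity>l\<in>?L. (t (?h l))\<^sup>2)"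
      using infsum_Cauchy_Schwarz[of "\<lambda>l. q (?h l)" ?L "\<lambda>l. t (?h l)"] sq(1) st(1) q0 t0 hl by auto
    have "((\<lambda>l. c (?h l)) has_sum (- c h)) ?L"
    proof (rule has_sum_dual_lattice[OF n h])
      fix k assume "k \<in> {1..n}"
      then show "((\<lambda>m. c m * fourier_char s m (lattice_point s n z k)) has_sum 0) ?I"
        using g[OF lattice_point_PiE, of n z k] g0 by simp
    qed
    moreover have "(\<lambda>l. norm (c (?h l))) summable_on ?L"
      by (rule summable_on_cong[THEN iffD2, OF qt[OF hl] CS(1)])
    ultimately have "norm (- c h) \<le> (\<Sum>\<^sub>\<infinity>l\<in>?L. norm (c (?h l)))"
      by (intro norm_has_sum_bound) auto
    also have "\<dots> = (\<Sum>\<^sub>\<infinity>l\<in>?L. q (?h l) * t (?h l))"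
      by (rule infsum_cong[OF qt[OF hl]])
    also have "\<dots> \<le> sqrt (\<Sum>\<^sub>\<infinity>l\<in>?L. (q (?h l))\<^sup>2) * sqrt (\<Sum>\<^sub>\<infinity>l\<in>?L. (t (?h l))\<^sup>2)"
      by (rule CS(2))
    also have "\<dots> \<le> 1 * sqrt (Q h)"
    proof (rule mult_mono)
      show "sqrt (\<Sum>\<^sub>\<infinity>l\<in>?L. (q (?h l))\<^sup>2) \<le> 1"
        using order_trans[OF sq(2) qs(2)] by simp
      show "sqrt (\<Sum>\<^sub>\<infinity>l\<in>?L. (t (?h l))\<^sup>2) \<le> sqrt (Q h)"
        using infsum_cong[of ?L "\<lambda>l. (t (?h l))\<^sup>2" "\<lambda>l. ?\<rho> (?h l)", OF t2[OF hl]] by (simp add: Q_def)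
    qed (auto intro!: infsum_nonneg)
    finally have "norm (c h) \<le> sqrt (Q h)" by simp
    moreover have "Q h \<ge> 0"
      unfolding Q_def by (rule infsum_nonneg) (use \<rho>0 hl less_imp_le in blast)
    ultimately show ?thesis
      by (metis norm_ge_zero power_mono real_sqrt_pow2)
  qed
  have S: "S_crit s \<alpha> \<gamma> n z = (\<Sum>\<^sub>\<infinity>h\<in>?I. ?\<rho> h * Q h)"
    unfolding S_crit_def Q_def inverse_r_mult by (intro infsum_cong infsum_cmult_right')
  have Qs: "(\<lambda>h. ?\<rho> h * Q h) summable_on ?I"
    using summable_on_Sigma_banach[of "\<lambda>h l. ?\<rho> h * ?\<rho> (\<lambda>j. h j + l j)" ?I "\<lambda>_. ?L"]
      shifted_rho_summable[OF \<alpha> \<gamma> L]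
    by (simp add: shifted_prod_def Q_def infsum_cmult_right')
  \<comment> \<open>For the second Cauchy-Schwarz step, the square of \<open>norm (c h)\<close> is
    split as \<open>q h\<close> times \<open>t h * norm (c h)\<close>; by \<open>cQ\<close> the
    squares of the latter sum to at most \<open>S_crit\<close>.\<close>
  have tc: "(t h * norm (c h))\<^sup>2 \<le> ?\<rho> h * Q h" if "h \<in> ?I" for h
    using t2[OF that] cQ[OF that] \<rho>0[OF that] by (simp add: power_mult_distrib)
  have tcs: "(\<lambda>h. (t h * norm (c h))\<^sup>2) summable_on ?I"
    by (rule summable_on_comparison_test[OF Qs tc]) auto
  have "((\<lambda>h. (norm (c h))\<^sup>2) has_sum (\<integral>x. (g x)\<^sup>2 \<partial>unit_cube s)) ?I"
    by (rule Parseval[OF c g[OF unit_cube_PiE]])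
  then have "(\<integral>x. (g x)\<^sup>2 \<partial>unit_cube s) = (\<Sum>\<^sub>\<infinity>h\<in>?I. (norm (c h))\<^sup>2)"
    by (simp add: infsumI)
  also have "\<dots> = (\<Sum>\<^sub>\<infinity>h\<in>?I. q h * (t h * norm (c h)))"
    by (rule infsum_cong) (simp add: qt power2_eq_square mult_ac)
  also have "\<dots> \<le> sqrt (\<Sum>\<^sub>\<infinity>h\<in>?I. (q h)\<^sup>2) * sqrt (\<Sum>\<^sub>\<infinity>h\<in>?I. (t h * norm (c h))\<^sup>2)"
    by (rule infsum_Cauchy_Schwarz(2)[OF qs(1) tcs]) (use q0 t0 in auto)
  also have "\<dots> \<le> 1 * sqrt (S_crit s \<alpha> \<gamma> n z)"
    using qs(2) infsum_mono[OF tcs Qs tc] by (intro mult_mono) (auto simp: S intro!: infsum_nonneg)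
  \<comment> \<open>One square root comes from Cauchy-Schwarz, the other from
    \<open>L2_norm\<close>; hence the exponent 1/4.\<close>
  finally have "L2_norm s g \<le> sqrt (sqrt (S_crit s \<alpha> \<gamma> n z))"
    by (simp add: L2_norm_def)
  also have "\<dots> = S_crit s \<alpha> \<gamma> n z powr (1 / 4)"
    using S_crit_nonneg[OF \<alpha> \<gamma>] by (simp add: powr_powr flip: powr_half_sqrt)
  finally show ?thesis .
qed

section \<open>The kernel interpolant\<close>

lemma kernel_combination_has_sum:
  assumes "\<alpha> > 1"
  shows "((\<lambda>h. of_real (rho \<alpha> \<gamma> h) * (\<Sum>k\<in>F. of_real (a k) * cnj (fourier_char s h (x k))) * fourier_char s h y)
    has_sum of_real (\<Sum>k\<in>F. a k * kernel s \<alpha> \<gamma> (x k) y)) (int_vecs s)"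
proof -
  \<comment> \<open>Conjugating the kernel series, whose sum is real, puts the unconjugated
    character on the second argument and makes it a Fourier series in \<open>y\<close>.\<close>
  have "((\<lambda>h. \<Sum>k\<in>F. of_real (a k) * (of_real (rho \<alpha> \<gamma> h) * (cnj (fourier_char s h (x k)) * fourier_char s h y)))
      has_sum (\<Sum>k\<in>F. of_real (a k) * of_real (kernel s \<alpha> \<gamma> (x k) y))) (int_vecs s)"
    using has_sum_cnj_iff[THEN iffD2, OF kernel_has_sum[OF assms]]
    by (intro has_sum_sum has_sum_cmult_right) simp
  then show ?thesis
    by (simp add: sum_distrib_left sum_distrib_right mult_ac)
qed

text \<open>The quadratic form of the kernel matrix is the sum of \<open>rho\<close> times the
  squared modulus of \<open>v\<close>. If it vanishes, positivity of \<open>rho\<close> forces every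
  \<open>v h\<close>, hence every coefficient of the combination, to be 0. The conclusion is about
  the function and not about \<open>b\<close>, which is the uniqueness that \<open>THE\<close> in
  \<open>kernel_interpolant\<close> asks for.\<close>

lemma kernel_combination_eq_0:
  fixes b :: "nat \<Rightarrow> real"
  assumes \<alpha>: "\<alpha> > 1" and \<gamma>: "weights \<gamma>"
    and zero: "\<And>j. j \<in> F \<Longrightarrow> (\<Sum>k\<in>F. b k * kernel s \<alpha> \<gamma> (x k) (x j)) = 0"
  shows "(\<Sum>k\<in>F. b k * kernel s \<alpha> \<gamma> (x k) y) = 0"
proof -
  define v where "v h = (\<Sum>k\<in>F. of_real (b k) * cnj (fourier_char s h (x k)))" for h
  have v_cnj: "cnj (v h) = (\<Sum>k\<in>F. of_real (b k) * fourier_char s h (x k))" for h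
    by (simp add: v_def)
  have "((\<lambda>h. \<Sum>j\<in>F. of_real (b j) * (of_real (rho \<alpha> \<gamma> h) * v h * fourier_char s h (x j)))
      has_sum (\<Sum>j\<in>F. of_real (b j) * of_real (\<Sum>k\<in>F. b k * kernel s \<alpha> \<gamma> (x k) (x j)))) (int_vecs s)"
    unfolding v_def by (intro has_sum_sum has_sum_cmult_right kernel_combination_has_sum[OF \<alpha>])
  also have "(\<lambda>h. \<Sum>j\<in>F. of_real (b j) * (of_real (rho \<alpha> \<gamma> h) * v h * fourier_char s h (x j))) =
      (\<lambda>h. complex_of_real (rho \<alpha> \<gamma> h * (norm (v h))\<^sup>2))"
    unfolding of_real_mult complex_norm_square v_cnj by (simp add: sum_distrib_left mult_ac)
  also have "(\<Sum>j\<in>F. of_real (b j) * of_real (\<Sum>k\<in>F. b k * kernel s \<alpha> \<gamma> (x k) (x j))) = complex_of_real 0"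
    by (simp add: zero)
  finally have sum0: "((\<lambda>h. rho \<alpha> \<gamma> h * (norm (v h))\<^sup>2) has_sum 0) (int_vecs s)"
    by (simp only: has_sum_of_real_iff)
  have "v h = 0" if "h \<in> int_vecs s" for h
  proof -
    have "rho \<alpha> \<gamma> h * (norm (v h))\<^sup>2 = 0"
      by (rule nonneg_has_sum_le_0D[OF sum0 _ _ that]) (use rho_nonneg[OF \<gamma>] in auto)
    then show ?thesis using rho_pos[OF \<gamma> that, of \<alpha>] by simp
  qed
  then have "((\<lambda>h. of_real (rho \<alpha> \<gamma> h) * v h * fourier_char s h y) has_sum 0) (int_vecs s)"
    by (intro has_sum_0) simp
  with kernel_combination_has_sum[OF \<alpha>, where \<gamma> = \<gamma> and F = F and a = b and s = s and x = x and y = y]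
  have "complex_of_real (\<Sum>k\<in>F. b k * kernel s \<alpha> \<gamma> (x k) y) = 0"
    unfolding v_def using has_sum_unique by blast
  then show ?thesis by (simp only: of_real_eq_0_iff)
qed

section \<open>Solvability of the interpolation equations\<close>

lemma exists_dot:
  assumes "prime n" "s \<ge> 1" "z 1 \<in> {1..n - 1}"
  obtains h where "h \<in> int_vecs s" "int n dvd m + dot s z h"
proof -
  \<comment> \<open>\<open>z 1\<close> is invertible modulo \<open>n\<close>, so multiples of the
    first coordinate vector already reach every residue class.\<close>
  have "\<not> n dvd z 1" using assms(3) by (auto dest: dvd_imp_le)
  then have "coprime (z 1) n"
    using prime_imp_coprime[OF assms(1)] coprime_commute by blast
  then have "coprime (int (z 1)) (int n)" by simp
  then obtain x where x: "[int (z 1) * x = 1] (mod int n)"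
    using cong_solve_coprime_int by blast
  define h where "h j = (if j = 1 then - m * x else 0)" for j :: nat
  have "dot s z h = (\<Sum>j\<in>{1}. h j * int (z j))"
    unfolding dot_def by (rule sum.mono_neutral_right) (use assms(2) in \<open>auto simp: h_def\<close>)
  then have "m + dot s z h = - m * (int (z 1) * x - 1)"
    by (simp add: h_def algebra_simps)
  also have "int n dvd \<dots>"
    using x by (intro dvd_mult) (simp add: cong_iff_dvd_diff)
  finally have "int n dvd m + dot s z h" .
  moreover have "h \<in> int_vecs s" using assms(2) by (auto simp: h_def int_vecs_def)
  ultimately show ?thesis using that by blast
qed

text \<open>
  The kernel matrix at the lattice points is circulant, so the characters of the cyclic group are
  eigenvectors; the eigenvalue belonging to \<open>m\<close> is \<open>n\<close> times the quantity below.
\<close>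

definition kernel_eigenvalue :: "nat \<Rightarrow> real \<Rightarrow> (nat set \<Rightarrow> real) \<Rightarrow> nat \<Rightarrow> (nat \<Rightarrow> nat) \<Rightarrow> int \<Rightarrow> real" where
  "kernel_eigenvalue s \<alpha> \<gamma> n z m = infsum (rho \<alpha> \<gamma>) {h \<in> int_vecs s. int n dvd m + dot s z h}"

lemma kernel_eigenvalue_pos:
  assumes \<alpha>: "\<alpha> > 1" and \<gamma>: "weights \<gamma>" and n: "prime n" and s: "s \<ge> 1" and z: "z 1 \<in> {1..n - 1}"
  shows "kernel_eigenvalue s \<alpha> \<gamma> n z m > 0"
proof -
  obtain h where h: "h \<in> int_vecs s" "int n dvd m + dot s z h"
    using exists_dot[where z = z, OF n s z] .
  let ?A = "{h \<in> int_vecs s. int n dvd m + dot s z h}"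
  have "rho \<alpha> \<gamma> summable_on ?A"
    by (rule summable_on_subset_banach[OF rho_summable[OF \<alpha>, of \<gamma> s]]) auto
  then have "sum (rho \<alpha> \<gamma>) {h} \<le> infsum (rho \<alpha> \<gamma>) ?A"
    by (rule finite_sum_le_infsum) (use h rho_nonneg[OF \<gamma>] in auto)
  then show ?thesis
    using rho_pos[OF \<gamma> h(1), of \<alpha>] by (simp add: kernel_eigenvalue_def)
qed

lemma kernel_eigenvector:
  assumes \<alpha>: "\<alpha> > 1" and n: "n > 0"
  shows "(\<Sum>k=1..n. unit_root n (int k * m) *
      of_real (kernel s \<alpha> \<gamma> (lattice_point s n z k) (lattice_point s n z j))) =
    of_nat n * of_real (kernel_eigenvalue s \<alpha> \<gamma> n z m) * unit_root n (int j * m)"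
proof -
  let ?K = "\<lambda>k. kernel s \<alpha> \<gamma> (lattice_point s n z k) (lattice_point s n z j)"
  let ?A = "{h \<in> int_vecs s. int n dvd m + dot s z h}"
  have "((\<lambda>h. \<Sum>k=1..n. unit_root n (int k * m) * (of_real (rho \<alpha> \<gamma> h) *
      (unit_root n (int k * dot s z h) * cnj (unit_root n (int j * dot s z h)))))
      has_sum (\<Sum>k=1..n. unit_root n (int k * m) * of_real (?K k))) (int_vecs s)"
    using kernel_has_sum[OF \<alpha>, of \<gamma> s "lattice_point s n z _" "lattice_point s n z j"]
    unfolding fourier_char_lattice by (intro has_sum_sum has_sum_cmult_right)
  also have "(\<lambda>h. \<Sum>k=1..n. unit_root n (int k * m) * (of_real (rho \<alpha> \<gamma> h) *
      (unit_root n (int k * dot s z h) * cnj (unit_root n (int j * dot s z h))))) =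
      (\<lambda>h. if int n dvd m + dot s z h then of_nat n * unit_root n (int j * m) * of_real (rho \<alpha> \<gamma> h) else 0)"
  proof
    fix h
    have "(\<Sum>k=1..n. unit_root n (int k * m) * (of_real (rho \<alpha> \<gamma> h) *
        (unit_root n (int k * dot s z h) * cnj (unit_root n (int j * dot s z h))))) =
        of_real (rho \<alpha> \<gamma> h) * cnj (unit_root n (int j * dot s z h)) *
        (\<Sum>k=1..n. unit_root n (int k * (m + dot s z h)))"
      by (simp add: sum_distrib_left distrib_left unit_root_add mult_ac)
    also have "\<dots> = (if int n dvd m + dot s z h then of_nat n * unit_root n (int j * m) * of_real (rho \<alpha> \<gamma> h) else 0)"
    proof (cases "int n dvd m + dot s z h")
      case True
      then have "unit_root n (int j * (m + dot s z h)) = 1"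
        using unit_root_eq_1_iff[OF n] by (simp add: dvd_mult)
      \<comment> \<open>For the surviving \<open>h\<close>, \<open>m\<close> and
        \<open>- dot s z h\<close> agree modulo \<open>n\<close>, so the factor depending on
        \<open>h\<close> becomes the entry of the eigenvector at \<open>j\<close>.\<close>
      then have "unit_root n (int j * m) = cnj (unit_root n (int j * dot s z h))"
        using unit_root_diff[of n "int j * (m + dot s z h)" "int j * dot s z h"] by (simp add: algebra_simps)
      then show ?thesis using True unfolding sum_unit_root[OF n] by simp
    next
      case False
      then show ?thesis unfolding sum_unit_root[OF n] by simp
    qed
    finally show "(\<Sum>k=1..n. unit_root n (int k * m) * (of_real (rho \<alpha> \<gamma> h) *
        (unit_root n (int k * dot s z h) * cnj (unit_root n (int j * dot s z h))))) =
      (if int n dvd m + dot s z h then of_nat n * unit_root n (int j * m) * of_real (rho \<alpha> \<gamma> h) else 0)" .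
  qed
  finally have "((\<lambda>h. of_nat n * unit_root n (int j * m) * of_real (rho \<alpha> \<gamma> h)) has_sum
      (\<Sum>k=1..n. unit_root n (int k * m) * of_real (?K k))) ?A"
    by (rule has_sum_cong_neutral[THEN iffD1, rotated 3]) auto
  moreover have "(rho \<alpha> \<gamma> has_sum kernel_eigenvalue s \<alpha> \<gamma> n z m) ?A"
    unfolding kernel_eigenvalue_def
    by (intro has_sum_infsum summable_on_subset_banach[OF rho_summable[OF \<alpha>, of \<gamma> s]]) auto
  then have "((\<lambda>h. of_nat n * unit_root n (int j * m) * of_real (rho \<alpha> \<gamma> h)) has_sum
      of_nat n * unit_root n (int j * m) * of_real (kernel_eigenvalue s \<alpha> \<gamma> n z m)) ?A"
    by (intro has_sum_cmult_right has_sum_of_real)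
  ultimately have "(\<Sum>k=1..n. unit_root n (int k * m) * of_real (?K k)) =
      of_nat n * unit_root n (int j * m) * of_real (kernel_eigenvalue s \<alpha> \<gamma> n z m)"
    by (rule has_sum_unique)
  then show ?thesis by (simp add: mult_ac)
qed

lemma interpolant_exists:
  fixes y :: "nat \<Rightarrow> real"
  assumes \<alpha>: "\<alpha> > 1" and \<gamma>: "weights \<gamma>" and n: "prime n" and s: "s \<ge> 1" and z: "z 1 \<in> {1..n - 1}"
  obtains a :: "nat \<Rightarrow> real" where
    "\<And>j. j \<in> {1..n} \<Longrightarrow> (\<Sum>k=1..n. a k * kernel s \<alpha> \<gamma> (lattice_point s n z k) (lattice_point s n z j)) = y j"
proof -
  have n0: "n > 0" using n by (simp add: prime_gt_0_nat)
  let ?K = "\<lambda>k j. kernel s \<alpha> \<gamma> (lattice_point s n z k) (lattice_point s n z j)"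
  define \<mu> where "\<mu> m = kernel_eigenvalue s \<alpha> \<gamma> n z (int m)" for m
  have \<mu>: "\<mu> m \<noteq> 0" for m
    using kernel_eigenvalue_pos[where z = z and m = "int m", OF \<alpha> \<gamma> n s z] by (simp add: \<mu>_def)
  define \<phi> where "\<phi> m = (\<Sum>i=1..n. of_real (y i) * cnj (unit_root n (int m * int i)))" for m
  \<comment> \<open>The transform \<open>\<phi>\<close> of the data is divided by the eigenvalue
    \<open>n * \<mu> m\<close> and transformed back; the second factor \<open>n\<close> normalises
    the inversion.\<close>
  define a where "a k = (\<Sum>m=1..n. \<phi> m / (of_nat n * of_nat n * of_real (\<mu> m)) * unit_root n (int k * int m))" for k
  have "(\<Sum>k=1..n. a k * of_real (?K k j)) = of_real (y j)" if j: "j \<in> {1..n}" for j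
  proof -
    have "(\<Sum>k=1..n. a k * of_real (?K k j)) =
        (\<Sum>m=1..n. \<phi> m / (of_nat n * of_nat n * of_real (\<mu> m)) *
          (\<Sum>k=1..n. unit_root n (int k * int m) * of_real (?K k j)))"
      unfolding a_def sum_distrib_left sum_distrib_right
      by (subst sum.swap) (simp add: mult.assoc)
    also have "\<dots> = (\<Sum>m=1..n. \<phi> m / of_nat n * unit_root n (int j * int m))"
      unfolding kernel_eigenvector[OF \<alpha> n0] \<mu>_def[symmetric]
      by (intro sum.cong refl) (use \<mu> n0 in \<open>simp add: field_simps\<close>)
    also have "\<dots> = (\<Sum>i=1..n. of_real (y i) / of_nat n * (\<Sum>m=1..n. unit_root n (int m * (int j - int i))))"
      unfolding \<phi>_def sum_distrib_left sum_distrib_right sum_divide_distrib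
      by (subst sum.swap) (simp add: right_diff_distrib unit_root_diff mult_ac)
    also have "\<dots> = (\<Sum>i=1..n. if i = j then of_real (y j) else 0)"
    proof (rule sum.cong[OF refl])
      fix i assume i: "i \<in> {1..n}"
      have "int n dvd int j - int i \<longleftrightarrow> i = j"
      proof
        assume dvd: "int n dvd int j - int i"
        show "i = j"
        proof (rule ccontr)
          assume "i \<noteq> j"
          then have "int n \<le> \<bar>int j - int i\<bar>"
            using dvd_imp_le_int[OF _ dvd] by simp
          then show False using i j by auto
        qed
      qed simp
      then show "of_real (y i) / of_nat n * (\<Sum>m=1..n. unit_root n (int m * (int j - int i))) =
          (if i = j then of_real (y j) else 0)"
        using n0 unfolding sum_unit_root[OF n0] by simp
    qed
    also have "\<dots> = of_real (y j)" using j by simp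
    finally show ?thesis .
  qed
  \<comment> \<open>Kernel and data are real, so the real parts of the complex coefficients solve
    the same equations.\<close>
  then have "Re (\<Sum>k=1..n. a k * of_real (?K k j)) = y j" if "j \<in> {1..n}" for j
    using that by simp
  then show ?thesis
    by (intro that[of "\<lambda>k. Re (a k)"]) simp
qed

text \<open>Two interpolating combinations differ by one that vanishes at all nodes, hence
  everywhere; with existence this gives the definite description its meaning.\<close>

lemma kernel_interpolant_obtain:
  assumes \<alpha>: "\<alpha> > 1" and \<gamma>: "weights \<gamma>" and n: "prime n" and s: "s \<ge> 1" and z: "z 1 \<in> {1..n - 1}"
  obtains a :: "nat \<Rightarrow> real" where
    "kernel_interpolant s \<alpha> \<gamma> n z f = (\<lambda>y. \<Sum>k=1..n. a k * kernel s \<alpha> \<gamma> (lattice_point s n z k) y)"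
    "\<And>j. j \<in> {1..n} \<Longrightarrow> kernel_interpolant s \<alpha> \<gamma> n z f (lattice_point s n z j) = f (lattice_point s n z j)"
proof -
  let ?t = "lattice_point s n z"
  let ?G = "\<lambda>a y. \<Sum>k=1..n. a k * kernel s \<alpha> \<gamma> (?t k) y"
  let ?P = "\<lambda>g. (\<exists>a :: nat \<Rightarrow> real. g = ?G a) \<and> (\<forall>k\<in>{1..n}. g (?t k) = f (?t k))"
  obtain a where a: "\<And>j. j \<in> {1..n} \<Longrightarrow> ?G a (?t j) = f (?t j)"
    using interpolant_exists[where z = z, OF assms, where y = "\<lambda>j. f (?t j)"] by blast
  have "?P (kernel_interpolant s \<alpha> \<gamma> n z f)"
    unfolding kernel_interpolant_def
  proof (rule theI[where P = ?P and a = "?G a"])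
    show "?P (?G a)" using a by blast
  next
    fix g assume "?P g"
    then obtain b where b: "g = ?G b" "\<And>j. j \<in> {1..n} \<Longrightarrow> g (?t j) = f (?t j)" by blast
    have "(\<Sum>k=1..n. (b k - a k) * kernel s \<alpha> \<gamma> (?t k) y) = 0" for y
      by (rule kernel_combination_eq_0[OF \<alpha> \<gamma>])
         (use a b in \<open>simp add: left_diff_distrib sum_subtractf\<close>)
    then show "g = ?G a"
      unfolding b(1) by (intro ext) (simp add: left_diff_distrib sum_subtractf)
  qed
  then show ?thesis using that by blast
qed

text \<open>
  The interpolant is the orthogonal projection onto the span of the kernel sections, because the
  inner product with a kernel section is evaluation at its point; hence the error has norm at most 1.
\<close>

lemma wce_le:
  assumes \<alpha>: "\<alpha> > 1" and \<gamma>: "weights \<gamma>" and n: "prime n" and s: "s \<ge> 1" and z: "z 1 \<in> {1..n - 1}"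
  shows "wce s \<alpha> \<gamma> n z \<le> ereal (S_crit s \<alpha> \<gamma> n z powr (1 / 4))"
  unfolding wce_def
proof (rule SUP_least)
  fix f assume "f \<in> {f \<in> H_space s \<alpha> \<gamma>. H_norm s \<alpha> \<gamma> f \<le> 1}"
  then have f: "f \<in> H_space s \<alpha> \<gamma>" "H_norm s \<alpha> \<gamma> f \<le> 1" by auto
  let ?I = "int_vecs s" and ?t = "lattice_point s n z" and ?\<rho> = "rho \<alpha> \<gamma>" and ?r = "r \<alpha> \<gamma>"
  define \<psi> where "\<psi> = fourier_coeff s f"
  have n0: "n > 0" using n by (simp add: prime_gt_0_nat)
  have \<psi>1: "(\<lambda>h. norm (\<psi> h)) summable_on ?I"
    and \<psi>2: "\<And>x. x \<in> {1..s} \<rightarrow>\<^sub>E UNIV \<Longrightarrow> ((\<lambda>h. \<psi> h * fourier_char s h x) has_sum of_real (f x)) ?I"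
    and \<psi>3: "(\<lambda>h. ?r h * (norm (\<psi> h))\<^sup>2) summable_on ?I"
    using f(1) by (auto simp: H_space_def \<psi>_def)
  have \<psi>4: "(\<Sum>\<^sub>\<infinity>h\<in>?I. ?r h * (norm (\<psi> h))\<^sup>2) \<le> 1"
    using f(2) by (simp add: H_norm_def \<psi>_def)
  obtain a where a: "kernel_interpolant s \<alpha> \<gamma> n z f = (\<lambda>y. \<Sum>k=1..n. a k * kernel s \<alpha> \<gamma> (?t k) y)"
    "\<And>j. j \<in> {1..n} \<Longrightarrow> kernel_interpolant s \<alpha> \<gamma> n z f (?t j) = f (?t j)"
    using kernel_interpolant_obtain[where z = z and f = f, OF assms] by blast
  define g where "g x = f x - kernel_interpolant s \<alpha> \<gamma> n z f x" for x
  have g0: "g (?t k) = 0" if "k \<in> {1..n}" for k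
    using a(2)[OF that] by (simp add: g_def)
  \<comment> \<open>The interpolant has Fourier coefficients \<open>rho h * v h\<close>, so
    \<open>c\<close> are those of the error \<open>g\<close>.\<close>
  define v where "v h = (\<Sum>k=1..n. of_real (a k) * cnj (fourier_char s h (?t k)))" for h
  define c where "c h = \<psi> h - of_real (?\<rho> h) * v h" for h
  define V where "V = (\<Sum>k=1..n. \<bar>a k\<bar>)"
  have vV: "norm (v h) \<le> V" for h
    unfolding v_def V_def by (rule order_trans[OF norm_sum]) (simp add: norm_mult)
  have \<rho>0: "?\<rho> h > 0" if "h \<in> ?I" for h using rho_pos[OF \<gamma> that] .
  have \<rho>s: "?\<rho> summable_on ?I" by (rule rho_summable[OF \<alpha>])
  have \<rho>vs: "(\<lambda>h. norm (of_real (?\<rho> h) * v h)) summable_on ?I"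
    by (rule summable_on_comparison_test[OF summable_on_cmult_left[OF \<rho>s, of V]])
       (use vV \<rho>0 in \<open>auto simp: norm_mult less_imp_le\<close>)
  have cs: "(\<lambda>h. norm (c h)) summable_on ?I"
    by (rule summable_on_comparison_test[OF summable_on_add[OF \<psi>1 \<rho>vs]])
       (auto simp: c_def norm_triangle_ineq4)
  have cg: "((\<lambda>h. c h * fourier_char s h x) has_sum of_real (g x)) ?I" if "x \<in> {1..s} \<rightarrow>\<^sub>E UNIV" for x
    using has_sum_diff[OF \<psi>2[OF that] kernel_combination_has_sum[OF \<alpha>, where \<gamma> = \<gamma> and F = "{1..n}" and a = a and s = s and x = ?t and y = x]]
    by (simp add: c_def g_def a(1) v_def left_diff_distrib)
  \<comment> \<open>The equations expressing that \<open>g\<close> vanishes at the nodes are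
    combined with weights \<open>a k\<close>. Because \<open>r\<close> times \<open>rho\<close> is
    1, the sum is the inner product of the error with the interpolant.\<close>
  have orth: "((\<lambda>h. c h * cnj (v h)) has_sum 0) ?I"
  proof -
    have "((\<lambda>h. \<Sum>k=1..n. of_real (a k) * (c h * fourier_char s h (?t k))) has_sum
        (\<Sum>k=1..n. of_real (a k) * of_real (g (?t k)))) ?I"
      by (intro has_sum_sum has_sum_cmult_right cg lattice_point_PiE)
    moreover have "(\<lambda>h. \<Sum>k=1..n. of_real (a k) * (c h * fourier_char s h (?t k))) = (\<lambda>h. c h * cnj (v h))"
      by (simp add: v_def sum_distrib_left mult_ac)
    moreover have "(\<Sum>k=1..n. of_real (a k) * of_real (g (?t k))) = (0 :: complex)"
      using g0 by (intro sum.neutral) simp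
    ultimately show ?thesis by simp
  qed
  have b: "(\<lambda>h. ?\<rho> h * (norm (v h))\<^sup>2) summable_on ?I"
    by (rule summable_on_comparison_test[OF summable_on_cmult_left[OF \<rho>s, of "V\<^sup>2"]])
       (use vV \<rho>0 in \<open>auto simp: less_imp_le power_mono intro!: mult_left_mono\<close>)
  \<comment> \<open>Pythagoras for error plus interpolant, coefficient by coefficient; the cross
    term sums to 0 by \<open>orth\<close>.\<close>
  have pyth: "?r h * (norm (c h))\<^sup>2 = ?r h * (norm (\<psi> h))\<^sup>2 - ?\<rho> h * (norm (v h))\<^sup>2 - 2 * Re (c h * cnj (v h))"
    if h: "h \<in> ?I" for h
  proof -
    have \<psi>: "\<psi> h = c h + of_real (?\<rho> h) * v h" by (simp add: c_def)
    have "(norm (\<psi> h))\<^sup>2 = (norm (c h))\<^sup>2 + (?\<rho> h)\<^sup>2 * (norm (v h))\<^sup>2 + 2 * (?\<rho> h * Re (c h * cnj (v h)))"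
      unfolding \<psi> cmod_power2 by simp (simp add: power2_eq_square algebra_simps)
    then have "?r h * (norm (\<psi> h))\<^sup>2 = ?r h * (norm (c h))\<^sup>2 + (?r h * ?\<rho> h) * ?\<rho> h * (norm (v h))\<^sup>2
        + 2 * ((?r h * ?\<rho> h) * Re (c h * cnj (v h)))"
      by (simp only: distrib_left power2_eq_square mult_ac)
    then show ?thesis by (simp add: r_rho[OF \<gamma> h])
  qed
  have "((\<lambda>h. ?r h * (norm (\<psi> h))\<^sup>2 - ?\<rho> h * (norm (v h))\<^sup>2 - 2 * Re (c h * cnj (v h))) has_sum
      (\<Sum>\<^sub>\<infinity>h\<in>?I. ?r h * (norm (\<psi> h))\<^sup>2) - (\<Sum>\<^sub>\<infinity>h\<in>?I. ?\<rho> h * (norm (v h))\<^sup>2) - 2 * Re 0) ?I"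
    by (intro has_sum_diff has_sum_infsum \<psi>3 b has_sum_cmult_right has_sum_Re orth)
  then have rc: "((\<lambda>h. ?r h * (norm (c h))\<^sup>2) has_sum
      (\<Sum>\<^sub>\<infinity>h\<in>?I. ?r h * (norm (\<psi> h))\<^sup>2) - (\<Sum>\<^sub>\<infinity>h\<in>?I. ?\<rho> h * (norm (v h))\<^sup>2)) ?I"
    by (subst has_sum_cong[OF pyth]) simp_all
  have "(\<Sum>\<^sub>\<infinity>h\<in>?I. ?\<rho> h * (norm (v h))\<^sup>2) \<ge> 0"
    using \<rho>0 by (intro infsum_nonneg) (simp add: less_imp_le)
  then have "L2_norm s g \<le> S_crit s \<alpha> \<gamma> n z powr (1 / 4)"
    using infsumI[OF rc] \<psi>4
    by (intro L2_norm_le[OF \<alpha> \<gamma> n0 cs cg has_sum_imp_summable[OF rc] _ g0]) auto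
  then show "ereal (L2_norm s (\<lambda>x. f x - kernel_interpolant s \<alpha> \<gamma> n z f x)) \<le> ereal (S_crit s \<alpha> \<gamma> n z powr (1 / 4))"
    by (simp add: g_def[abs_def])
qed

section \<open>The error bound\<close>

definition weight_sum :: "nat \<Rightarrow> real \<Rightarrow> (nat set \<Rightarrow> real) \<Rightarrow> real \<Rightarrow> real" where
  "weight_sum s \<alpha> \<gamma> p =
    (\<Sum>u\<in>Pow {1..s}. real (max (card u) 1) * \<gamma> u powr p * (2 * zeta (\<alpha> * p)) ^ card u)"

lemma S_crit_quarter_powr_le:
  assumes \<alpha>: "\<alpha> > 1" and \<gamma>: "weights \<gamma>" and p: "p \<in> {1 / \<alpha> <.. 1}"
    and n: "prime n" and z: "cbc_vector s \<alpha> \<gamma> n z"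
  shows "sqrt 2 * S_crit s \<alpha> \<gamma> n z powr (1 / 4)
    \<le> kappa \<alpha> p / real n powr (1 / (4 * p)) * weight_sum s \<alpha> \<gamma> p powr (1 / (2 * p))"
proof -
  have ap: "\<alpha> * p > 1" using p \<alpha> by (simp add: field_simps)
  have p0: "0 < p" "p \<le> 1" using p \<alpha> by (auto intro: less_trans[of 0 "1 / \<alpha>"])
  have n0: "n > 0" using n by (simp add: prime_gt_0_nat)
  define S where "S = S_crit s \<alpha> \<gamma> n z"
  define W where "W = weight_sum s \<alpha> \<gamma> p"
  define \<tau> where "\<tau> = max 6 (2.5 + 2 powr (2 * \<alpha> * p + 1))"
  have S: "S \<ge> 0" unfolding S_def by (rule S_crit_nonneg[OF \<alpha> \<gamma>])
  have W: "W \<ge> 0"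
    unfolding W_def weight_sum_def using zeta_pos[OF ap] by (intro sum_nonneg mult_nonneg_nonneg) auto
  have "2 + 2 * 2 powr (\<alpha> * p) \<le> \<tau>"
  proof -
    have "2 powr (\<alpha> * p) \<le> 2 powr (2 * \<alpha> * p)"
      using ap by (intro powr_mono) auto
    moreover have "2 powr (2 * \<alpha> * p + 1) = 2 * 2 powr (2 * \<alpha> * p)"
      by (simp add: powr_add)
    ultimately have "2 + 2 * 2 powr (\<alpha> * p) \<le> 2.5 + 2 powr (2 * \<alpha> * p + 1)" by linarith
    then show ?thesis unfolding \<tau>_def by (rule max.coboundedI2)
  qed
  then have "(2 + 2 * 2 powr (\<alpha> * p)) / real n * W\<^sup>2 \<le> \<tau> / real n * W\<^sup>2"
    by (intro mult_right_mono divide_right_mono) auto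
  with S_crit_powr_le[OF \<alpha> \<gamma> p0 ap n z] have "S powr p \<le> \<tau> / real n * W\<^sup>2"
    by (simp add: S_def W_def weight_sum_def)
  then have "(S powr p) powr (1 / (4 * p)) \<le> (\<tau> / real n * W\<^sup>2) powr (1 / (4 * p))"
    using p0 by (intro powr_mono2) auto
  also have "(S powr p) powr (1 / (4 * p)) = S powr (1 / 4)"
    using p0 by (simp add: powr_powr)
  also have "(\<tau> / real n * W\<^sup>2) powr (1 / (4 * p)) =
      \<tau> powr (1 / (4 * p)) / real n powr (1 / (4 * p)) * (W\<^sup>2) powr (1 / (4 * p))"
    by (simp add: powr_mult powr_divide \<tau>_def)
  also have "(W\<^sup>2) powr (1 / (4 * p)) = W powr (1 / (2 * p))"
  proof (cases "W = 0")
    case False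
    then have "W\<^sup>2 = W powr 2" using W by (simp add: powr_numeral)
    then show ?thesis by (simp add: powr_powr)
  qed simp
  finally have "sqrt 2 * S powr (1 / 4) \<le>
      sqrt 2 * (\<tau> powr (1 / (4 * p)) / real n powr (1 / (4 * p)) * W powr (1 / (2 * p)))"
    by (rule mult_left_mono) simp
  then show ?thesis
    by (simp only: kappa_def S_def W_def \<tau>_def times_divide_eq_right times_divide_eq_left mult.assoc)
qed

lemma cbc_vector_first: "cbc_vector s \<alpha> \<gamma> n z \<Longrightarrow> s \<ge> 1 \<Longrightarrow> z 1 \<in> {1..n - 1}"
  unfolding cbc_vector_def by (drule bspec[of _ _ 1]) simp_all

text \<open>The second claim leaves \<open>B\<close> and \<open>b\<close> free: \<open>B\<close>
  becomes the weight sum itself for fixed \<open>s\<close>, or the sum over all finite sets, and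
  \<open>b\<close> may be smaller than \<open>1 / (4 * p)\<close>, which matters when
  \<open>p\<close> is capped at 1.\<close>

lemma wce_le_weight_sum:
  assumes \<alpha>: "\<alpha> > 1" and \<gamma>: "weights \<gamma>" and p: "p \<in> {1 / \<alpha> <.. 1}"
    and n: "prime n" and z: "cbc_vector s \<alpha> \<gamma> n z" and s: "s \<ge> 1"
  shows "wce s \<alpha> \<gamma> n z \<le> ereal (sqrt 2 * S_crit s \<alpha> \<gamma> n z powr (1 / 4))"
    and "weight_sum s \<alpha> \<gamma> p \<le> B \<Longrightarrow> b \<le> 1 / (4 * p) \<Longrightarrow>
      wce s \<alpha> \<gamma> n z \<le> ereal (kappa \<alpha> p * B powr (1 / (2 * p)) * real n powr (- b))"
proof -
  have "1 * S_crit s \<alpha> \<gamma> n z powr (1 / 4) \<le> sqrt 2 * S_crit s \<alpha> \<gamma> n z powr (1 / 4)"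
    by (rule mult_right_mono) auto
  with wce_le[where z = z, OF \<alpha> \<gamma> n s cbc_vector_first[OF z s]]
  show 1: "wce s \<alpha> \<gamma> n z \<le> ereal (sqrt 2 * S_crit s \<alpha> \<gamma> n z powr (1 / 4))"
    by (simp add: order_trans)
  assume B: "weight_sum s \<alpha> \<gamma> p \<le> B" and b: "b \<le> 1 / (4 * p)"
  have ap: "\<alpha> * p > 1" using p \<alpha> by (simp add: field_simps)
  have p0: "0 < p" using p \<alpha> by (auto intro: less_trans[of 0 "1 / \<alpha>"])
  have n1: "real n \<ge> 1" using n prime_ge_1_nat by (simp add: Suc_le_eq prime_gt_0_nat)
  have W: "weight_sum s \<alpha> \<gamma> p \<ge> 0"
    unfolding weight_sum_def using zeta_pos[OF ap] by (intro sum_nonneg mult_nonneg_nonneg) auto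
  have \<kappa>: "kappa \<alpha> p \<ge> 0" by (simp add: kappa_def)
  note S_crit_quarter_powr_le[OF \<alpha> \<gamma> p n z]
  also have "kappa \<alpha> p / real n powr (1 / (4 * p)) * weight_sum s \<alpha> \<gamma> p powr (1 / (2 * p)) =
      kappa \<alpha> p * weight_sum s \<alpha> \<gamma> p powr (1 / (2 * p)) * real n powr (- (1 / (4 * p)))"
    by (simp only: powr_minus divide_inverse mult.assoc mult.commute mult.left_commute)
  also have "\<dots> \<le> kappa \<alpha> p * B powr (1 / (2 * p)) * real n powr (- b)"
  proof (rule mult_mono)
    show "kappa \<alpha> p * weight_sum s \<alpha> \<gamma> p powr (1 / (2 * p)) \<le> kappa \<alpha> p * B powr (1 / (2 * p))"
      using B W \<kappa> p0 by (intro mult_left_mono powr_mono2) auto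
    show "real n powr (- (1 / (4 * p))) \<le> real n powr (- b)"
      using b n1 by (intro powr_mono) auto
  qed (use \<kappa> in auto)
  finally show "wce s \<alpha> \<gamma> n z \<le> ereal (kappa \<alpha> p * B powr (1 / (2 * p)) * real n powr (- b))"
    using 1 by (auto intro: order_trans)
qed

lemma weight_sum_le_infsum:
  fixes \<gamma> :: "nat set \<Rightarrow> real" and \<alpha> p :: real
  defines "f \<equiv> (\<lambda>u. real (max (card u) 1) * \<gamma> u powr p * (2 * zeta (\<alpha> * p)) ^ card u)"
  assumes \<alpha>: "\<alpha> * p > 1" and s: "f summable_on {u. finite u \<and> u \<subseteq> {1..}}"
  shows "weight_sum s \<alpha> \<gamma> p \<le> infsum f {u. finite u \<and> u \<subseteq> {1..}}"
proof -
  have "sum f (Pow {1..s}) \<le> infsum f {u. finite u \<and> u \<subseteq> {1..}}"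
  proof (rule finite_sum_le_infsum[OF s])
    show "Pow {1..s} \<subseteq> {u. finite u \<and> u \<subseteq> {1..}}" using finite_subset[of _ "{1..s}"] by auto
    show "0 \<le> f u" for u
      unfolding f_def using zeta_pos[OF \<alpha>] by (intro mult_nonneg_nonneg) auto
  qed simp
  then show ?thesis by (simp add: weight_sum_def f_def)
qed

theorem theorem4:
  fixes \<alpha> :: real and \<gamma> :: "nat set \<Rightarrow> real"
  assumes "\<alpha> > 1" and "weights \<gamma>"
  shows
    "(\<forall>s\<ge>1. \<forall>n z. prime n \<and> cbc_vector s \<alpha> \<gamma> n z \<longrightarrow>
        (\<forall>p\<in>{1 / \<alpha> <.. 1}.
          wce s \<alpha> \<gamma> n z \<le> ereal (sqrt 2 * S_crit s \<alpha> \<gamma> n z powr (1 / 4)) \<and>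
          sqrt 2 * S_crit s \<alpha> \<gamma> n z powr (1 / 4)
            \<le> kappa \<alpha> p / real n powr (1 / (4 * p)) *
              (\<Sum>u\<in>Pow {1..s}. real (max (card u) 1) * \<gamma> u powr p * (2 * zeta (\<alpha> * p)) ^ card u)
                powr (1 / (2 * p))))
     \<and>
     (\<forall>\<delta>\<in>{0 <..< \<alpha> / 4}.
        (\<forall>s\<ge>1. \<exists>C. \<forall>n z. prime n \<and> cbc_vector s \<alpha> \<gamma> n z \<longrightarrow>
            wce s \<alpha> \<gamma> n z \<le> ereal (C * real n powr (- \<alpha> / 4 + \<delta>))) \<and>
        (\<alpha> - 4 * \<delta> \<ge> 1 \<and>
         (\<lambda>u. real (max (card u) 1) * \<gamma> u powr (1 / (\<alpha> - 4 * \<delta>)) *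
                (2 * zeta (\<alpha> / (\<alpha> - 4 * \<delta>))) ^ card u)
           summable_on {u. finite u \<and> u \<subseteq> {1..}} \<longrightarrow>
         (\<exists>C. \<forall>s\<ge>1. \<forall>n z. prime n \<and> cbc_vector s \<alpha> \<gamma> n z \<longrightarrow>
            wce s \<alpha> \<gamma> n z \<le> ereal (C * real n powr (- \<alpha> / 4 + \<delta>)))) \<and>
        (\<alpha> - 4 * \<delta> < 1 \<and>
         (\<lambda>u. real (max (card u) 1) * \<gamma> u * (2 * zeta \<alpha>) ^ card u)
           summable_on {u. finite u \<and> u \<subseteq> {1..}} \<longrightarrow>
         (\<exists>C. \<forall>s\<ge>1. \<forall>n z. prime n \<and> cbc_vector s \<alpha> \<gamma> n z \<longrightarrow>
            wce s \<alpha> \<gamma> n z \<le> ereal (C * real n powr (- \<alpha> / 4 + \<delta>)))))"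
proof (intro conjI allI impI ballI; (elim conjE)?)
  fix s n z p assume "s \<ge> 1" "p \<in> {1 / \<alpha> <.. 1}" "prime n" "cbc_vector s \<alpha> \<gamma> n z"
  then show "wce s \<alpha> \<gamma> n z \<le> ereal (sqrt 2 * S_crit s \<alpha> \<gamma> n z powr (1 / 4))"
    and "sqrt 2 * S_crit s \<alpha> \<gamma> n z powr (1 / 4)
            \<le> kappa \<alpha> p / real n powr (1 / (4 * p)) *
              (\<Sum>u\<in>Pow {1..s}. real (max (card u) 1) * \<gamma> u powr p * (2 * zeta (\<alpha> * p)) ^ card u)
                powr (1 / (2 * p))"
    using wce_le_weight_sum(1)[OF assms] S_crit_quarter_powr_le[OF assms] unfolding weight_sum_def by auto
next
  fix \<delta> assume \<delta>: "\<delta> \<in> {0 <..< \<alpha> / 4}"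
  have rate: "- \<alpha> / 4 + \<delta> = - ((\<alpha> - 4 * \<delta>) / 4)" by (simp add: field_simps)
  \<comment> \<open>\<open>1 / (\<alpha> - 4 * \<delta>)\<close> makes \<open>1 / (4 * p)\<close>
    exactly the required rate, but is at most 1 only if
    \<open>\<alpha> - 4 * \<delta> \<ge> 1\<close>. Otherwise \<open>p = 1\<close> is taken, whose
    rate 1/4 exceeds the required one.\<close>
  define p where "p = (if \<alpha> - 4 * \<delta> \<ge> 1 then 1 / (\<alpha> - 4 * \<delta>) else 1)"
  have p: "p \<in> {1 / \<alpha> <.. 1}" "(\<alpha> - 4 * \<delta>) / 4 \<le> 1 / (4 * p)" "\<alpha> * p > 1"
    using \<delta> assms(1) by (auto simp: p_def field_simps)
  have bound: "wce s \<alpha> \<gamma> n z \<le> ereal (kappa \<alpha> p * B powr (1 / (2 * p)) * real n powr (- \<alpha> / 4 + \<delta>))"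
    if "s \<ge> 1" "prime n \<and> cbc_vector s \<alpha> \<gamma> n z" "weight_sum s \<alpha> \<gamma> p \<le> B" for s n z B
    unfolding rate
    by (rule wce_le_weight_sum(2)[OF assms p(1) conjunct1[OF that(2)] conjunct2[OF that(2)] that(1,3) p(2)])
  show "\<exists>C. \<forall>n z. prime n \<and> cbc_vector s \<alpha> \<gamma> n z \<longrightarrow>
      wce s \<alpha> \<gamma> n z \<le> ereal (C * real n powr (- \<alpha> / 4 + \<delta>))" if "s \<ge> 1" for s
    by (rule exI[of _ "kappa \<alpha> p * weight_sum s \<alpha> \<gamma> p powr (1 / (2 * p))"])
       (intro allI impI bound[OF that _ order_refl])
  \<comment> \<open>The sum over all finite coordinate sets bounds \<open>weight_sum\<close> for
    every \<open>s\<close> at once, so the constant is independent of the dimension.\<close>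
  have uniform: "\<exists>C. \<forall>s\<ge>1. \<forall>n z. prime n \<and> cbc_vector s \<alpha> \<gamma> n z \<longrightarrow>
      wce s \<alpha> \<gamma> n z \<le> ereal (C * real n powr (- \<alpha> / 4 + \<delta>))"
    if "(\<lambda>u. real (max (card u) 1) * \<gamma> u powr p * (2 * zeta (\<alpha> * p)) ^ card u)
      summable_on {u. finite u \<and> u \<subseteq> {1..}}"
    by (rule exI[of _ "kappa \<alpha> p * (\<Sum>\<^sub>\<infinity>u\<in>{u. finite u \<and> u \<subseteq> {1..}}.
          real (max (card u) 1) * \<gamma> u powr p * (2 * zeta (\<alpha> * p)) ^ card u) powr (1 / (2 * p))"])
       (intro allI impI bound[OF _ _ weight_sum_le_infsum[OF p(3) that]])
  show "\<exists>C. \<forall>s\<ge>1. \<forall>n z. prime n \<and> cbc_vector s \<alpha> \<gamma> n z \<longrightarrow>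
      wce s \<alpha> \<gamma> n z \<le> ereal (C * real n powr (- \<alpha> / 4 + \<delta>))"
    if "\<alpha> - 4 * \<delta> \<ge> 1"
      "(\<lambda>u. real (max (card u) 1) * \<gamma> u powr (1 / (\<alpha> - 4 * \<delta>)) *
        (2 * zeta (\<alpha> / (\<alpha> - 4 * \<delta>))) ^ card u) summable_on {u. finite u \<and> u \<subseteq> {1..}}"
    by (rule uniform) (use that in \<open>simp add: p_def\<close>)
  show "\<exists>C. \<forall>s\<ge>1. \<forall>n z. prime n \<and> cbc_vector s \<alpha> \<gamma> n z \<longrightarrow>
      wce s \<alpha> \<gamma> n z \<le> ereal (C * real n powr (- \<alpha> / 4 + \<delta>))"
    if "\<alpha> - 4 * \<delta> < 1"
      "(\<lambda>u. real (max (card u) 1) * \<gamma> u * (2 * zeta \<alpha>) ^ card u)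
        summable_on {u. finite u \<and> u \<subseteq> {1..}}"
  proof (rule uniform)
    have "p = 1" using that(1) by (simp add: p_def)
    moreover have "\<gamma> u powr 1 = \<gamma> u" if "u \<in> {u. finite u \<and> u \<subseteq> {1..}}" for u
      using assms(2) that unfolding weights_def by (intro powr_one) (auto intro: less_imp_le)
    ultimately show "(\<lambda>u. real (max (card u) 1) * \<gamma> u powr p * (2 * zeta (\<alpha> * p)) ^ card u)
        summable_on {u. finite u \<and> u \<subseteq> {1..}}"
      by (intro summable_on_cong[THEN iffD1, OF _ that(2)]) simp
  qed
qed

end
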